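(* Let $\mathcal{M},\mathcal{M}'\in\mathbb{R}^{k\times n}$ be independent random matrices each with i.i.d. $\mathcal{N}(0,1)$ entries, and $\overline{\mathcal{M}}(\tau)=\cos(\tau)\mathcal{M}+\sin(\tau)\mathcal{M}'$. Set $\tau=n^{-0.02}$. Then there is a function $g(n)=o(n)$ such that \[ \mathbb{P}\Bigl[d_H\bigl(\mathcal{A}_{\rm KR}(\mathcal{M}),\mathcal{A}_{\rm KR}(\overline{\mathcal{M}}(\tau))\bigr)\le g(n)\Bigr]\ge 1-O\bigl(n^{-1/41}\bigr). \]
   Context: $d_H$ is Hamming distance on $\{-1,1\}^n$. The number of constraints satisfies $k=\lfloor \alpha n\rfloor$ for a fixed $\alpha\in(0,0.005)$ (so $k=\Theta(n)$). Logarithms are base 10. The Kim–Roche algorithm $\mathcal{A}_{\rm KR}:\mathbb{R}^{k\times n}\to\{-1,1\}^n$: fix a constant $C>0$ and let $N=\lceil C\log_{10}\log_{10}n\rceil$. Let $f_0=1$, $f_1=1/200$, $f_j=10^{-2^j}$ for $2\le j\le N$; $k_0=k$, $k_1=2\lfloor n/(2\cdot10^8)\rfloor+1$, $k_s=2\lfloor nf_s^3/2\rfloor+1$ for $2\le s\le N$; $A=\sum_{0\le j\le N}f_j$; $n_0=\lfloor n/A\rfloor$ and $n_j=\lfloor\frac nA\sum_{i\le j}f_i\rfloor-\lfloor\frac nA\sum_{i\le j-1}f_i\rfloor$ for $1\le j\le N$; $S_j=\sum_{s\le j}n_s$, $S_{-1}=0$. Given input $\mathcal{M}$ with rows $R_1,\dots,R_k$: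 in round $0$ set $\sigma_t=\mathrm{sgn}(\sum_{i=1}^k\mathcal{M}_{it})$ for $1\le t\le n_0$. In round $j\ge1$, compute the partial inner products $p_i=\sum_{t\le S_{j-1}}\mathcal{M}_{it}\sigma_t$, let $\mathcal{I}_j$ be the set of $k_j$ indices $i$ with the smallest $p_i$, and set $\sigma_t=\mathrm{sgn}(\sum_{i\in\mathcal{I}_j}\mathcal{M}_{it})$ for $S_{j-1}<t\le S_j$. After round $N$ output $\sigma$ (ties occur with probability zero for Gaussian input). *)

theory Defs
  imports "HOL-Probability.Probability" "HOL-Library.Landau_Symbols"
begin

text \<open>
  A \<open>k \<times> n\<close> matrix is a function \<open>nat \<Rightarrow> nat \<Rightarrow> real\<close> of which only the entries with row index
  in \<open>{..<k}\<close> and column index in \<open>{..<n}\<close> matter; a vector in \<open>{-1,1}\<^sup>n\<close> is an element of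
  \<open>{..<n} \<rightarrow>\<^sub>E {-1, 1}\<close>. All indices start at 0.
\<close>

definition hamming_dist :: "nat \<Rightarrow> (nat \<Rightarrow> real) \<Rightarrow> (nat \<Rightarrow> real) \<Rightarrow> nat" where
  "hamming_dist n x y = card {t. t < n \<and> x t \<noteq> y t}"

section \<open>The Kim--Roche algorithm\<close>

text \<open>
  If the iterated logarithm is negative or meaningless (\<open>n < 10\<close>), this is 0.
\<close>

definition kr_N :: "real \<Rightarrow> nat \<Rightarrow> nat" where
  "kr_N C n = nat \<lceil>C * log 10 (log 10 (real n))\<rceil>"

definition kr_f :: "nat \<Rightarrow> real" where
  "kr_f j = (if j = 0 then 1 else if j = 1 then 1 / 200 else 1 / 10 ^ (2 ^ j))"

definition kr_k :: "nat \<Rightarrow> nat \<Rightarrow> nat \<Rightarrow> nat" where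
  "kr_k k n j =
     (if j = 0 then k
      else if j = 1 then 2 * nat \<lfloor>real n / (2 * 10 ^ 8)\<rfloor> + 1
      else 2 * nat \<lfloor>real n * kr_f j ^ 3 / 2\<rfloor> + 1)"

definition kr_A :: "real \<Rightarrow> nat \<Rightarrow> real" where
  "kr_A C n = (\<Sum>j\<le>kr_N C n. kr_f j)"

definition kr_n :: "real \<Rightarrow> nat \<Rightarrow> nat \<Rightarrow> nat" where
  "kr_n C n j =
     (if j = 0 then nat \<lfloor>real n / kr_A C n\<rfloor>
      else nat (\<lfloor>real n / kr_A C n * (\<Sum>i\<le>j. kr_f i)\<rfloor> - \<lfloor>real n / kr_A C n * (\<Sum>i\<le>j - 1. kr_f i)\<rfloor>))"

definition kr_S :: "real \<Rightarrow> nat \<Rightarrow> nat \<Rightarrow> nat" where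
  "kr_S C n j = (\<Sum>s\<le>j. kr_n C n s)"

text \<open>
  The value at 0 only matters on a null event; it keeps the output in \<open>{-1,1}\<close>.
\<close>

definition sgn_pm :: "real \<Rightarrow> real" where
  "sgn_pm x = (if 0 \<le> x then 1 else -1)"

text \<open>
  The indices in \<open>{..<k}\<close> of the \<open>m\<close> smallest values of \<open>p\<close>, ties being broken in favour of the
  smaller index. If \<open>m > k\<close>, as in the first rounds when \<open>k / n\<close> is very small, these
  are all indices.
\<close>

definition smallest_indices :: "nat \<Rightarrow> nat \<Rightarrow> (nat \<Rightarrow> real) \<Rightarrow> nat set" where
  "smallest_indices k m p =
     {i. i < k \<and> card {i'. i' < k \<and> (p i' < p i \<or> p i' = p i \<and> i' < i)} < m}"

text \<open>
  The partial assignment after round \<open>j\<close>; coordinates not yet assigned are \<open>undefined\<close>.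
\<close>

primrec kr_sigma :: "real \<Rightarrow> nat \<Rightarrow> nat \<Rightarrow> (nat \<Rightarrow> nat \<Rightarrow> real) \<Rightarrow> nat \<Rightarrow> nat \<Rightarrow> real" where
  "kr_sigma C k n M 0 =
     (\<lambda>t. if t < kr_S C n 0 then sgn_pm (\<Sum>i<k. M i t) else undefined)"
| "kr_sigma C k n M (Suc j) =
     (let \<sigma> = kr_sigma C k n M j;
          p = (\<lambda>i. \<Sum>t<kr_S C n j. M i t * \<sigma> t);
          I = smallest_indices k (kr_k k n (Suc j)) p
      in (\<lambda>t. if kr_S C n j \<le> t \<and> t < kr_S C n (Suc j) then sgn_pm (\<Sum>i\<in>I. M i t) else \<sigma> t))"

definition kim_roche :: "real \<Rightarrow> nat \<Rightarrow> nat \<Rightarrow> (nat \<Rightarrow> nat \<Rightarrow> real) \<Rightarrow> nat \<Rightarrow> real" where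
  "kim_roche C k n M = kr_sigma C k n M (kr_N C n)"

lemma kr_f_pos: "kr_f j > 0"
  by (simp add: kr_f_def)

lemma kr_A_pos: "kr_A C n > 0"
  unfolding kr_A_def by (rule sum_pos) (auto simp: kr_f_pos)

lemma kr_S_eq: "int (kr_S C n j) = \<lfloor>real n / kr_A C n * (\<Sum>i\<le>j. kr_f i)\<rfloor>"
proof (induction j)
  case 0
  show ?case using kr_A_pos[of C n] by (simp add: kr_S_def kr_n_def kr_f_def)
next
  case (Suc j)
  have "real n / kr_A C n * (\<Sum>i\<le>j. kr_f i) \<le> real n / kr_A C n * (\<Sum>i\<le>Suc j. kr_f i)"
    using kr_A_pos[of C n] kr_f_pos[of "Suc j"] by (intro mult_left_mono) auto
  then have "\<lfloor>real n / kr_A C n * (\<Sum>i\<le>j. kr_f i)\<rfloor> \<le> \<lfloor>real n / kr_A C n * (\<Sum>i\<le>Suc j. kr_f i)\<rfloor>"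
    by (rule floor_mono)
  then have "int (kr_n C n (Suc j)) =
      \<lfloor>real n / kr_A C n * (\<Sum>i\<le>Suc j. kr_f i)\<rfloor> - \<lfloor>real n / kr_A C n * (\<Sum>i\<le>j. kr_f i)\<rfloor>"
    unfolding kr_n_def by (simp del: sum.atMost_Suc)
  moreover have "kr_S C n (Suc j) = kr_S C n j + kr_n C n (Suc j)"
    by (simp add: kr_S_def)
  ultimately show ?case using Suc.IH by simp
qed

lemma kr_S_final: "kr_S C n (kr_N C n) = n"
proof -
  have "real n / kr_A C n * (\<Sum>i\<le>kr_N C n. kr_f i) = real n"
    using kr_A_pos[of C n] unfolding kr_A_def[symmetric] by simp
  then show ?thesis using kr_S_eq[of C n "kr_N C n"] by simp
qed

lemma kr_sigma_range: "kr_sigma C k n M j \<in> {..<kr_S C n j} \<rightarrow>\<^sub>E {-1, 1}"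
proof (induction j)
  case 0
  show ?case by (auto simp: PiE_iff extensional_def sgn_pm_def)
next
  case (Suc j)
  have "kr_S C n j \<le> kr_S C n (Suc j)" by (simp add: kr_S_def)
  with Suc show ?case by (auto simp: PiE_iff extensional_def sgn_pm_def Let_def not_le)
qed

lemma kim_roche_range: "kim_roche C k n M \<in> {..<n} \<rightarrow>\<^sub>E {-1, 1}"
  using kr_sigma_range[of C k n M "kr_N C n"] by (simp add: kim_roche_def kr_S_final)

lemma card_smallest_indices: "card (smallest_indices k m p) = min m k"
proof -
  define r where "r i = card {i'. i' < k \<and> (p i' < p i \<or> p i' = p i \<and> i' < i)}" for i
  have mono: "r i < r j" if "i < k" "p i < p j \<or> p i = p j \<and> i < j" for i j
    unfolding r_def by (rule psubset_card_mono) (use that in auto)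
  have inj: "inj_on r {..<k}"
    by (rule inj_onI) (metis mono lessThan_iff less_irrefl linorder_neqE)
  have sub: "r ` {..<k} \<subseteq> {..<k}"
  proof safe
    fix i assume "i < k"
    then have "r i < card {..<k}" unfolding r_def by (intro psubset_card_mono) auto
    then show "r i < k" by simp
  qed
  have im: "r ` {..<k} = {..<k}"
    by (rule card_subset_eq) (use sub card_image[OF inj] in auto)
  have eq: "smallest_indices k m p = {i \<in> {..<k}. r i < m}"
    by (auto simp: smallest_indices_def r_def)
  have "r ` {i \<in> {..<k}. r i < m} = {x \<in> r ` {..<k}. x < m}" by auto
  also have "\<dots> = {..<min m k}" unfolding im by auto
  finally have "r ` {i \<in> {..<k}. r i < m} = {..<min m k}" .
  moreover have "inj_on r {i \<in> {..<k}. r i < m}" by (rule inj_on_subset[OF inj]) auto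
  ultimately show ?thesis unfolding eq by (metis card_image card_lessThan)
qed

section \<open>Gaussian random matrices\<close>

definition iid_gaussian_matrix ::
  "'a measure \<Rightarrow> nat \<Rightarrow> nat \<Rightarrow> ('a \<Rightarrow> nat \<Rightarrow> nat \<Rightarrow> real) \<Rightarrow> bool" where
  "iid_gaussian_matrix \<Omega> k n X \<longleftrightarrow>
     (\<forall>i<k. \<forall>t<n. distributed \<Omega> lborel (\<lambda>\<omega>. X \<omega> i t) std_normal_density) \<and>
     prob_space.indep_vars \<Omega> (\<lambda>_. borel) (\<lambda>(i, t) \<omega>. X \<omega> i t) ({..<k} \<times> {..<n})"

definition indep_matrices ::
  "'a measure \<Rightarrow> nat \<Rightarrow> nat \<Rightarrow> ('a \<Rightarrow> nat \<Rightarrow> nat \<Rightarrow> real) \<Rightarrow> ('a \<Rightarrow> nat \<Rightarrow> nat \<Rightarrow> real) \<Rightarrow> bool" where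
  "indep_matrices \<Omega> k n X Y \<longleftrightarrow>
     prob_space.indep_var \<Omega>
       (\<Pi>\<^sub>M _\<in>{..<k} \<times> {..<n}. borel) (\<lambda>\<omega>. \<lambda>(i, t)\<in>{..<k} \<times> {..<n}. X \<omega> i t)
       (\<Pi>\<^sub>M _\<in>{..<k} \<times> {..<n}. borel) (\<lambda>\<omega>. \<lambda>(i, t)\<in>{..<k} \<times> {..<n}. Y \<omega> i t)"

definition interpolate ::
  "real \<Rightarrow> (nat \<Rightarrow> nat \<Rightarrow> real) \<Rightarrow> (nat \<Rightarrow> nat \<Rightarrow> real) \<Rightarrow> nat \<Rightarrow> nat \<Rightarrow> real" where
  "interpolate \<tau> X Y = (\<lambda>i t. cos \<tau> * X i t + sin \<tau> * Y i t)"

end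

theory Submission
  imports Defs "HOL-Real_Asymp.Real_Asymp"
begin

text \<open>
  The rounds after round \<open>J\<close> touch at most \<open>n / 2\<^sup>J + 1\<close> coordinates, so it suffices to show, for
  every fixed number of rounds, that at most \<open>\<epsilon> n\<close> coordinates change. This is deterministic on an
  event of probability \<open>1 - O(2\<^sup>-\<^sup>n)\<close>. Two properties hold simultaneously for all coefficient
  vectors \<open>x \<in> {-2, -1, 0, 1, 2}\<^sup>n\<close>, by a union bound over the at most \<open>5\<^sup>n\<close> of them: the norm of
  \<open>X x\<close> is at most \<open>4 \<surd>n \<bar>x\<bar>\<close>, and if \<open>\<bar>x\<bar>\<^sup>2 \<ge> \<kappa> n\<close> then no interval of length of order \<open>\<delta> \<surd>n\<close>
  contains more than \<open>\<eta> n\<close> entries of \<open>X x\<close>, where \<open>\<delta>\<close> depends only on \<open>\<kappa>\<close> and \<open>\<eta>\<close>. Because of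
  the union bound, the dependence of the partial assignments and of the selected row sets on the
  matrix plays no role. The first property bounds how far the partial inner products and the column
  sums move, the second one how many of them are close enough to the selection threshold, or to
  zero, for this movement to matter.
\<close>

section \<open>Linear combinations of the columns of a Gaussian matrix\<close>

context prob_space
begin

section \<open>Joint law of linear combinations formed from the rows\<close>

lemma indep_vars_reindex:
  assumes inj: "inj_on f I" and ind: "indep_vars M' X (f ` I)"
  shows "indep_vars (\<lambda>i. M' (f i)) (\<lambda>i. X (f i)) I"
  unfolding indep_vars_def2
proof (intro conjI ballI indep_setsI)
  show "random_variable (M' (f i)) (X (f i))" if "i \<in> I" for i
    using ind that by (auto simp: indep_vars_def2)
  show "{X (f i) -` A \<inter> space M |A. A \<in> sets (M' (f i))} \<subseteq> events" if "i \<in> I" for i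
    using ind that by (auto simp: indep_vars_def2)
next
  fix A J assume J: "J \<noteq> {}" "J \<subseteq> I" "finite J"
    and A: "\<forall>j\<in>J. A j \<in> {X (f j) -` A \<inter> space M |A. A \<in> sets (M' (f j))}"
  have injJ: "inj_on f J" using inj J(2) by (rule inj_on_subset)
  have ind': "indep_sets (\<lambda>i. {X i -` A \<inter> space M |A. A \<in> sets (M' i)}) (f ` I)"
    using ind by (simp add: indep_vars_def2)
  \<comment> \<open>The events chosen for \<open>J\<close> are carried to the image of
    \<open>J\<close> along the inverse of \<open>f\<close>, where the hypothesis applies.\<close>
  have "prob (\<Inter>j\<in>f ` J. A (the_inv_into J f j)) = (\<Prod>j\<in>f ` J. prob (A (the_inv_into J f j)))"
    by (rule indep_setsD[OF ind'])
       (use J A in \<open>auto simp: the_inv_into_f_f[OF injJ]\<close>)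
  then show "prob (\<Inter>j\<in>J. A j) = (\<Prod>j\<in>J. prob (A j))"
    by (simp add: prod.reindex[OF injJ] the_inv_into_f_f[OF injJ])
qed

lemma iid_gaussian_matrix_measurable:
  assumes "iid_gaussian_matrix M K T X" "i < K" "t < T"
  shows "(\<lambda>\<omega>. X \<omega> i t) \<in> borel_measurable M"
  using assms by (auto simp: iid_gaussian_matrix_def indep_vars_def dest!: bspec[of _ _ "(i, t)"])

text \<open>Column sums over selected rows are combinations of rows; transposing turns them into
  combinations of columns, so that one set of estimates serves both.\<close>

lemma iid_gaussian_matrix_transpose:
  assumes "iid_gaussian_matrix M K T X"
  shows "iid_gaussian_matrix M T K (\<lambda>\<omega> t i. X \<omega> i t)"
proof -
  have ind: "indep_vars (\<lambda>_. borel) (\<lambda>(i, t) \<omega>. X \<omega> i t) ({..<K} \<times> {..<T})"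
    using assms by (simp add: iid_gaussian_matrix_def)
  have "bij_betw prod.swap ({..<T} \<times> {..<K}) ({..<K} \<times> {..<T})"
    by (rule bij_betwI[where g = prod.swap]) auto
  then have "indep_vars (\<lambda>_. borel) (\<lambda>p. (\<lambda>(i, t) \<omega>. X \<omega> i t) (prod.swap p)) ({..<T} \<times> {..<K})"
    using ind indep_vars_reindex[of prod.swap "{..<T} \<times> {..<K}" "\<lambda>_. borel" "\<lambda>(i, t) \<omega>. X \<omega> i t"]
    by (simp add: bij_betw_def)
  then have "indep_vars (\<lambda>_. borel) (\<lambda>(t, i) \<omega>. X \<omega> i t) ({..<T} \<times> {..<K})"
    by (simp add: case_prod_unfold prod.swap_def)
  with assms show ?thesis
    by (auto simp: iid_gaussian_matrix_def)
qed

lemma row_combination_distributed: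
  assumes X: "iid_gaussian_matrix M K T X" and i: "i < K"
    and pos: "0 < (\<Sum>t<T. (x t)\<^sup>2)"
  shows "distributed M lborel (\<lambda>\<omega>. \<Sum>t<T. x t * X \<omega> i t)
           (normal_density 0 (sqrt (\<Sum>t<T. (x t)\<^sup>2)))"
proof -
  \<comment> \<open>Only the support of \<open>x\<close> enters: a zero coefficient would give a
    degenerate law, which has no density.\<close>
  define I where "I = {t. t < T \<and> x t \<noteq> 0}"
  have fin: "finite I" by (simp add: I_def)
  have I0: "I \<noteq> {}"
  proof
    assume "I = {}"
    then have "(\<Sum>t<T. (x t)\<^sup>2) = 0" by (intro sum.neutral) (auto simp: I_def)
    with pos show False by simp
  qed
  have ind: "indep_vars (\<lambda>_. borel) (\<lambda>(i, t) \<omega>. X \<omega> i t) ({..<K} \<times> {..<T})"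
    using X by (simp add: iid_gaussian_matrix_def)
  have "indep_vars (\<lambda>_. borel) (\<lambda>t. (\<lambda>(i, t) \<omega>. X \<omega> i t) (i, t)) I"
  proof (rule indep_vars_reindex[where M' = "\<lambda>_. borel" and f = "\<lambda>t. (i, t)"])
    show "inj_on (\<lambda>t. (i, t)) I" by (simp add: inj_on_def)
    show "indep_vars (\<lambda>_. borel) (\<lambda>(i, t) \<omega>. X \<omega> i t) ((\<lambda>t. (i, t)) ` I)"
      by (rule indep_vars_subset[OF ind]) (use i in \<open>auto simp: I_def\<close>)
  qed
  then have "indep_vars (\<lambda>_. borel) (\<lambda>t \<omega>. X \<omega> i t) I" by simp
  then have ind': "indep_vars (\<lambda>_. borel) (\<lambda>t \<omega>. x t * X \<omega> i t) I"
    by (rule indep_vars_compose2) auto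
  have nrm: "distributed M lborel (\<lambda>\<omega>. x t * X \<omega> i t) (normal_density 0 \<bar>x t\<bar>)" if "t \<in> I" for t
  proof -
    have "distributed M lborel (\<lambda>\<omega>. X \<omega> i t) (normal_density 0 1)"
      using X i that by (auto simp: iid_gaussian_matrix_def I_def)
    from normal_density_affine[OF this, of "x t" 0] that show ?thesis by (simp add: I_def)
  qed
  have *: "distributed M lborel (\<lambda>\<omega>. \<Sum>t\<in>I. x t * X \<omega> i t)
      (normal_density (\<Sum>t\<in>I. 0) (sqrt (\<Sum>t\<in>I. \<bar>x t\<bar>\<^sup>2)))"
    by (rule sum_indep_normal[OF fin I0 ind' _ nrm]) (auto simp: I_def)
  have "(\<Sum>t<T. x t * X \<omega> i t) = (\<Sum>t\<in>I. x t * X \<omega> i t)" for \<omega>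
    by (rule sum.mono_neutral_right) (auto simp: I_def)
  moreover have "(\<Sum>t<T. (x t)\<^sup>2) = (\<Sum>t\<in>I. \<bar>x t\<bar>\<^sup>2)"
    by (simp, rule sum.mono_neutral_right) (auto simp: I_def)
  ultimately show ?thesis using * by simp
qed

text \<open>Different rows use disjoint blocks of the independent entries, and each combination is a
  measurable function of its own block.\<close>

lemma row_combination_indep:
  assumes X: "iid_gaussian_matrix M K T X"
  shows "indep_vars (\<lambda>_. borel) (\<lambda>i \<omega>. \<Sum>t<T. x t * X \<omega> i t) {..<K}"
proof -
  have ind: "indep_vars (\<lambda>_. borel) (\<lambda>(i, t) \<omega>. X \<omega> i t) ({..<K} \<times> {..<T})"
    using X by (simp add: iid_gaussian_matrix_def)
  have "indep_vars (\<lambda>i. Pi\<^sub>M ({i} \<times> {..<T}) (\<lambda>_. borel))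
      (\<lambda>i \<omega>. restrict (\<lambda>p. (\<lambda>(i, t) \<omega>. X \<omega> i t) p \<omega>) ({i} \<times> {..<T})) {..<K}"
    by (rule indep_vars_restrict[OF ind]) (auto simp: disjoint_family_on_def)
  then have "indep_vars (\<lambda>_. borel)
      (\<lambda>i \<omega>. (\<lambda>i r. \<Sum>t<T. x t * r (i, t)) i
        (restrict (\<lambda>p. (\<lambda>(i, t) \<omega>. X \<omega> i t) p \<omega>) ({i} \<times> {..<T}))) {..<K}"
  proof (rule indep_vars_compose2)
    fix i
    have [measurable]: "(\<lambda>r. r (i, t)) \<in> borel_measurable (Pi\<^sub>M ({i} \<times> {..<T}) (\<lambda>_. borel))"
      if "t < T" for t
      by (rule measurable_component_singleton) (use that in auto)
    show "(\<lambda>r. \<Sum>t<T. x t * r (i, t)) \<in> borel_measurable (Pi\<^sub>M ({i} \<times> {..<T}) (\<lambda>_. borel))"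
      by measurable
  qed
  then show ?thesis by simp
qed

section \<open>Moment and window bounds for one row, and a product Markov bound\<close>

lemma normal_exp_square:
  assumes X: "distributed M lborel X (normal_density 0 \<sigma>)" and \<sigma>: "0 < \<sigma>"
  shows "(\<integral>\<^sup>+\<omega>. ennreal (exp ((X \<omega>)\<^sup>2 / (4 * \<sigma>\<^sup>2))) \<partial>M) \<le> 2"
proof -
  \<comment> \<open>The weight turns the density of variance \<open>\<sigma>\<^sup>2\<close> into
    \<open>sqrt 2\<close> times the density of variance \<open>2 * \<sigma>\<^sup>2\<close>, so the
    moment is exactly \<open>sqrt 2\<close>.\<close>
  have eq: "normal_density 0 \<sigma> x * exp (x\<^sup>2 / (4 * \<sigma>\<^sup>2)) = sqrt 2 * normal_density 0 (sqrt 2 * \<sigma>) x" for x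
  proof -
    have "exp (- (x\<^sup>2) / (2 * \<sigma>\<^sup>2)) * exp (x\<^sup>2 / (4 * \<sigma>\<^sup>2)) = exp (- (x\<^sup>2) / (4 * \<sigma>\<^sup>2))"
      unfolding exp_add[symmetric] using \<sigma> by (simp add: field_simps)
    moreover have "sqrt (2 * pi * (sqrt 2 * \<sigma>)\<^sup>2) = sqrt 2 * sqrt (2 * pi * \<sigma>\<^sup>2)"
      by (simp add: power_mult_distrib real_sqrt_mult)
    ultimately show ?thesis by (simp add: normal_density_def power_mult_distrib)
  qed
  have [measurable]: "X \<in> borel_measurable M" using distributed_measurable[OF X] by simp
  have "(\<integral>\<^sup>+\<omega>. ennreal (exp ((X \<omega>)\<^sup>2 / (4 * \<sigma>\<^sup>2))) \<partial>M)
      = (\<integral>\<^sup>+x. ennreal (normal_density 0 \<sigma> x) * ennreal (exp (x\<^sup>2 / (4 * \<sigma>\<^sup>2))) \<partial>lborel)"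
    by (rule distributed_nn_integral[OF X, symmetric]) auto
  also have "\<dots> = (\<integral>\<^sup>+x. ennreal (sqrt 2) * ennreal (normal_density 0 (sqrt 2 * \<sigma>) x) \<partial>lborel)"
    by (simp add: ennreal_mult''[symmetric] eq)
  also have "\<dots> = ennreal (sqrt 2) * (\<integral>\<^sup>+x. ennreal (normal_density 0 (sqrt 2 * \<sigma>) x) \<partial>lborel)"
    by (rule nn_integral_cmult) auto
  also have "(\<integral>\<^sup>+x. ennreal (normal_density 0 (sqrt 2 * \<sigma>) x) \<partial>lborel) = 1"
    using \<sigma> by (subst nn_integral_eq_integral) auto
  also have "ennreal (sqrt 2) * 1 \<le> 2"
  proof -
    have "sqrt 2 \<le> 2" by (rule real_le_lsqrt) auto
    then show ?thesis by (simp add: ennreal_le_iff2 flip: ennreal_numeral)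
  qed
  finally show ?thesis .
qed

text \<open>A normal density is at most \<open>1 / \<sigma>\<close>, and the window has length
  \<open>2 * w\<close>.\<close>

lemma normal_window:
  assumes X: "distributed M lborel X (normal_density 0 \<sigma>)" and \<sigma>: "0 < \<sigma>" and w: "0 \<le> w"
  shows "emeasure M {\<omega> \<in> space M. \<bar>X \<omega> - c\<bar> \<le> w} \<le> ennreal (2 * w / \<sigma>)"
proof -
  have [measurable]: "X \<in> borel_measurable M" using distributed_measurable[OF X] by simp
  have le: "normal_density 0 \<sigma> x \<le> 1 / \<sigma>" for x
  proof -
    have "2 * pi \<ge> 1" using pi_gt3 by simp
    then have "sqrt (2 * pi * \<sigma>\<^sup>2) \<ge> \<sigma>"
      using \<sigma> real_sqrt_ge_one[of "2 * pi"] by (simp add: real_sqrt_mult mult_le_cancel_right1)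
    then have "1 / sqrt (2 * pi * \<sigma>\<^sup>2) * exp (- (x - 0)\<^sup>2 / (2 * \<sigma>\<^sup>2)) \<le> 1 / \<sigma> * 1"
      using \<sigma> by (intro mult_mono divide_left_mono mult_pos_pos) (auto intro: less_le_trans)
    then show ?thesis by (simp add: normal_density_def)
  qed
  have "{\<omega> \<in> space M. \<bar>X \<omega> - c\<bar> \<le> w} = X -` {c - w..c + w} \<inter> space M" by auto
  then have "emeasure M {\<omega> \<in> space M. \<bar>X \<omega> - c\<bar> \<le> w}
      = (\<integral>\<^sup>+x. ennreal (normal_density 0 \<sigma> x) * indicator {c - w..c + w} x \<partial>lborel)"
    using distributed_emeasure[OF X, of "{c - w..c + w}"] by simp
  also have "\<dots> \<le> (\<integral>\<^sup>+x. ennreal (1 / \<sigma>) * indicator {c - w..c + w} x \<partial>lborel)"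
    by (intro nn_integral_mono mult_right_mono ennreal_leI le) auto
  also have "\<dots> = ennreal (2 * w / \<sigma>)"
    using w \<sigma> by (simp add: nn_integral_cmult_indicator ennreal_mult'[symmetric])
  finally show ?thesis .
qed

text \<open>Chernoff's method: independence factors the mean of the product into at most
  \<open>2 ^ K\<close>, and Markov's inequality does the rest. It is applied with \<open>f\<close>
  exponential in the square, for norms, and with \<open>f\<close> a weight on a window, for
  counting.\<close>

lemma indep_prod_markov:
  fixes f :: "real \<Rightarrow> real"
  assumes ind: "indep_vars (\<lambda>_. borel) R {..<K}" and [measurable]: "f \<in> borel_measurable borel"
    and f0: "\<And>x. 0 \<le> f x" and B: "0 < B"
    and le: "\<And>i. i < K \<Longrightarrow> (\<integral>\<^sup>+\<omega>. ennreal (f (R i \<omega>)) \<partial>M) \<le> 2"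
  shows "{\<omega> \<in> space M. B \<le> (\<Prod>i<K. f (R i \<omega>))} \<in> sets M"
    and "prob {\<omega> \<in> space M. B \<le> (\<Prod>i<K. f (R i \<omega>))} \<le> 2 ^ K / B"
proof -
  have [measurable]: "R i \<in> borel_measurable M" if "i < K" for i
    using ind that by (auto simp: indep_vars_def)
  have meas[measurable]: "(\<lambda>\<omega>. \<Prod>i<K. f (R i \<omega>)) \<in> borel_measurable M" by measurable
  show "{\<omega> \<in> space M. B \<le> (\<Prod>i<K. f (R i \<omega>))} \<in> sets M" by measurable
  \<comment> \<open>Rescaled to threshold 1, the form in which Markov's inequality is
    applied.\<close>
  have "emeasure M {\<omega> \<in> space M. B \<le> (\<Prod>i<K. f (R i \<omega>))}
      = emeasure M {\<omega> \<in> space M. 1 \<le> ennreal (1 / B) * ennreal (\<Prod>i<K. f (R i \<omega>))}"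
    using B by (auto intro!: arg_cong[where f = "emeasure M"] simp: ennreal_mult''[symmetric] prod_nonneg f0 field_simps)
  also have "\<dots> \<le> ennreal (1 / B) * (\<integral>\<^sup>+\<omega>. ennreal (\<Prod>i<K. f (R i \<omega>)) * indicator (space M) \<omega> \<partial>M)"
    by (rule nn_integral_Markov_inequality) measurable
  also have "(\<integral>\<^sup>+\<omega>. ennreal (\<Prod>i<K. f (R i \<omega>)) * indicator (space M) \<omega> \<partial>M)
      = (\<integral>\<^sup>+\<omega>. (\<Prod>i<K. ennreal (f (R i \<omega>))) \<partial>M)"
    by (intro nn_integral_cong) (simp add: prod_ennreal f0)
  also have "\<dots> = (\<Prod>i<K. \<integral>\<^sup>+\<omega>. ennreal (f (R i \<omega>)) \<partial>M)"
    by (intro indep_vars_nn_integral indep_vars_compose2[OF ind]) auto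
  also have "ennreal (1 / B) * \<dots> \<le> ennreal (1 / B) * (\<Prod>i<K. 2)"
    by (intro mult_left_mono prod_mono_ennreal le) auto
  also have "ennreal (1 / B) * (\<Prod>i<K. 2) = ennreal (2 ^ K / B)"
    using B by (simp add: ennreal_power ennreal_mult'[symmetric] del: ennreal_numeral flip: ennreal_numeral)
  finally have "emeasure M {\<omega> \<in> space M. B \<le> (\<Prod>i<K. f (R i \<omega>))} \<le> ennreal (2 ^ K / B)" .
  then show "prob {\<omega> \<in> space M. B \<le> (\<Prod>i<K. f (R i \<omega>))} \<le> 2 ^ K / B"
    using B by (simp add: emeasure_eq_measure)
qed

end

section \<open>Properties that fail with exponentially small probability\<close>

text \<open>
  The bound is uniform over all samples \<open>X\<close> in the class \<open>H\<close>. The exceptional set is a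
  measurable superset, so that \<open>Q\<close> itself need not define an event.
\<close>

definition whp :: "(nat \<Rightarrow> 'a measure \<Rightarrow> ('a \<Rightarrow> 'b) \<Rightarrow> bool) \<Rightarrow> (nat \<Rightarrow> 'b \<Rightarrow> bool) \<Rightarrow> bool" where
  "whp H Q \<longleftrightarrow> (\<exists>A. \<forall>\<^sub>F n in sequentially. \<forall>\<Omega> X. H n \<Omega> X \<longrightarrow>
     (\<exists>E\<in>sets \<Omega>. measure \<Omega> E \<le> A / 2 ^ n \<and> (\<forall>\<omega>\<in>space \<Omega> - E. Q n (X \<omega>))))"

lemma whpI:
  assumes "\<And>n \<Omega> X. H n \<Omega> X \<Longrightarrow> \<exists>E\<in>sets \<Omega>. measure \<Omega> E \<le> A / 2 ^ n \<and> (\<forall>\<omega>\<in>space \<Omega> - E. Q n (X \<omega>))"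
  shows "whp H Q"
  unfolding whp_def using assms by (intro exI[of _ A] always_eventually) blast

lemma whp_eventually:
  assumes "\<forall>\<^sub>F n in sequentially. \<forall>x. Q n x"
  shows "whp H Q"
  unfolding whp_def using assms
  by (intro exI[of _ 0]) (auto elim!: eventually_mono intro!: bexI[of _ "{}"])

text \<open>The exceptional sets are united and their constants added.\<close>

lemma whp_conj:
  assumes "whp H Q" "whp H R"
  shows "whp H (\<lambda>n x. Q n x \<and> R n x)"
proof -
  obtain A where
    A: "\<forall>\<^sub>F n in sequentially. \<forall>\<Omega> X. H n \<Omega> X \<longrightarrow>
     (\<exists>E\<in>sets \<Omega>. measure \<Omega> E \<le> A / 2 ^ n \<and> (\<forall>\<omega>\<in>space \<Omega> - E. Q n (X \<omega>)))"
    using assms(1) unfolding whp_def ..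
  obtain B where
    B: "\<forall>\<^sub>F n in sequentially. \<forall>\<Omega> X. H n \<Omega> X \<longrightarrow>
     (\<exists>E\<in>sets \<Omega>. measure \<Omega> E \<le> B / 2 ^ n \<and> (\<forall>\<omega>\<in>space \<Omega> - E. R n (X \<omega>)))"
    using assms(2) unfolding whp_def ..
  from A B have "\<forall>\<^sub>F n in sequentially. \<forall>\<Omega> X. H n \<Omega> X \<longrightarrow>
     (\<exists>E\<in>sets \<Omega>. measure \<Omega> E \<le> (A + B) / 2 ^ n \<and> (\<forall>\<omega>\<in>space \<Omega> - E. Q n (X \<omega>) \<and> R n (X \<omega>)))"
  proof eventually_elim
    case (elim n)
    show ?case
    proof (intro allI impI)
      fix \<Omega> X assume H: "H n \<Omega> X"
      obtain E where E: "E \<in> sets \<Omega>" "measure \<Omega> E \<le> A / 2 ^ n" "\<forall>\<omega>\<in>space \<Omega> - E. Q n (X \<omega>)"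
        using elim(1)[rule_format, OF H] by blast
      obtain F where F: "F \<in> sets \<Omega>" "measure \<Omega> F \<le> B / 2 ^ n" "\<forall>\<omega>\<in>space \<Omega> - F. R n (X \<omega>)"
        using elim(2)[rule_format, OF H] by blast
      have "measure \<Omega> (E \<union> F) \<le> (A + B) / 2 ^ n"
        using measure_Un_le[OF E(1) F(1)] E(2) F(2) by (simp add: add_divide_distrib)
      then show "\<exists>E\<in>sets \<Omega>. measure \<Omega> E \<le> (A + B) / 2 ^ n \<and> (\<forall>\<omega>\<in>space \<Omega> - E. Q n (X \<omega>) \<and> R n (X \<omega>))"
        using E F by (intro bexI[of _ "E \<union> F"]) auto
    qed
  qed
  then show ?thesis unfolding whp_def ..
qed

lemma whp_mono:
  assumes "whp H Q" and "\<forall>\<^sub>F n in sequentially. \<forall>x. Q n x \<longrightarrow> R n x"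
  shows "whp H R"
proof -
  obtain A where
    "\<forall>\<^sub>F n in sequentially. \<forall>\<Omega> X. H n \<Omega> X \<longrightarrow>
     (\<exists>E\<in>sets \<Omega>. measure \<Omega> E \<le> A / 2 ^ n \<and> (\<forall>\<omega>\<in>space \<Omega> - E. Q n (X \<omega>)))"
    using assms(1) unfolding whp_def ..
  with assms(2) have "\<forall>\<^sub>F n in sequentially. \<forall>\<Omega> X. H n \<Omega> X \<longrightarrow>
     (\<exists>E\<in>sets \<Omega>. measure \<Omega> E \<le> A / 2 ^ n \<and> (\<forall>\<omega>\<in>space \<Omega> - E. R n (X \<omega>)))"
    by eventually_elim metis
  then show ?thesis unfolding whp_def ..
qed

text \<open>Since \<open>whp\<close> is uniform over all samples in the class, a bound for one class
  passes to every class that maps into it. This is how either matrix of a pair, or its transpose,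
  inherits estimates.\<close>

lemma whp_transform:
  assumes "whp H Q" and "\<And>n \<Omega> X. H' n \<Omega> X \<Longrightarrow> H n \<Omega> (\<lambda>\<omega>. f (X \<omega>))"
  shows "whp H' (\<lambda>n x. Q n (f x))"
proof -
  obtain A where
    "\<forall>\<^sub>F n in sequentially. \<forall>\<Omega> X. H n \<Omega> X \<longrightarrow>
     (\<exists>E\<in>sets \<Omega>. measure \<Omega> E \<le> A / 2 ^ n \<and> (\<forall>\<omega>\<in>space \<Omega> - E. Q n (X \<omega>)))"
    using assms(1) unfolding whp_def ..
  then have "\<forall>\<^sub>F n in sequentially. \<forall>\<Omega> X. H' n \<Omega> X \<longrightarrow>
     (\<exists>E\<in>sets \<Omega>. measure \<Omega> E \<le> A / 2 ^ n \<and> (\<forall>\<omega>\<in>space \<Omega> - E. Q n (f (X \<omega>))))"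
    by eventually_elim (use assms(2) in blast)
  then show ?thesis unfolding whp_def ..
qed

section \<open>Uniform bound on the norm\<close>

definition gaussian_model ::
  "(nat \<Rightarrow> nat) \<Rightarrow> (nat \<Rightarrow> nat) \<Rightarrow> nat \<Rightarrow> 'a measure \<Rightarrow> ('a \<Rightarrow> nat \<Rightarrow> nat \<Rightarrow> real) \<Rightarrow> bool" where
  "gaussian_model K T n \<Omega> X \<longleftrightarrow> prob_space \<Omega> \<and> iid_gaussian_matrix \<Omega> (K n) (T n) X"

text \<open>The differences of two vectors with entries in \<open>{-1, 0, 1}\<close> have entries in this set.\<close>

abbreviation small_ints :: "real set" where
  "small_ints \<equiv> {-2, -1, 0, 1, 2}"

text \<open>The estimate of the operator norm by \<open>4 * sqrt n\<close>, asked only of vectors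
  with entries in a finite set, so that a plain union bound replaces a net.\<close>

definition norm_bounded :: "nat \<Rightarrow> nat \<Rightarrow> nat \<Rightarrow> (nat \<Rightarrow> nat \<Rightarrow> real) \<Rightarrow> bool" where
  "norm_bounded n K T X \<longleftrightarrow> (\<forall>x\<in>{..<T} \<rightarrow> small_ints.
     (\<Sum>i<K. (\<Sum>t<T. x t * X i t)\<^sup>2) \<le> 16 * real n * (\<Sum>t<T. (x t)\<^sup>2))"

text \<open>The union bound runs over the finite set of extensional vectors, whereas vectors arising
  later are arbitrary outside \<open>{..<T}\<close>; this passes from the latter to the
  former.\<close>

lemma restrict_small_ints:
  assumes "x \<in> {..<T} \<rightarrow> small_ints"
  shows "restrict x {..<T} \<in> {..<T} \<rightarrow>\<^sub>E small_ints"
    and "(\<Sum>t<T. restrict x {..<T} t * X i t) = (\<Sum>t<T. x t * X i t)"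
    and "(\<Sum>t<T. (restrict x {..<T} t)\<^sup>2) = (\<Sum>t<T. (x t)\<^sup>2)"
  using assms by (auto intro!: sum.cong)

lemma (in prob_space) prob_UN_le:
  fixes b :: real
  assumes "finite I" "\<And>i. i \<in> I \<Longrightarrow> F i \<in> events" "\<And>i. i \<in> I \<Longrightarrow> prob (F i) \<le> b"
  shows "prob (\<Union>i\<in>I. F i) \<le> card I * b"
proof -
  have "prob (\<Union>i\<in>I. F i) \<le> (\<Sum>i\<in>I. prob (F i))"
    using assms by (intro finite_measure_subadditive_finite) auto
  also have "\<dots> \<le> card I * b"
    using assms(3) by (rule sum_bounded_above)
  finally show ?thesis .
qed

text \<open>For a fixed nonzero \<open>x\<close>, the sum of the squared row sums, divided by four
  times the squared norm of \<open>x\<close>, has exponential moment at most \<open>2 ^ n\<close>.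
  Markov's inequality at level \<open>exp (4 * n)\<close> and a union over at most
  \<open>5 ^ n\<close> vectors leave \<open>(10 / 20) ^ n\<close>.\<close>

lemma whp_norm_bounded:
  assumes K: "\<And>n. K n \<le> n" and T: "\<And>n. T n \<le> n"
  shows "whp (gaussian_model K T) (\<lambda>n X. norm_bounded n (K n) (T n) X)"
proof (rule whpI[where A = 1])
  fix n and \<Omega> :: "'a measure" and X assume H: "gaussian_model K T n \<Omega> X"
  then interpret prob_space \<Omega> by (simp add: gaussian_model_def)
  have X: "iid_gaussian_matrix \<Omega> (K n) (T n) X" using H by (simp add: gaussian_model_def)
  \<comment> \<open>The zero vector is left out, since its row sums have no density and
    \<open>s x\<close> is a divisor; it is treated separately at the end.\<close>
  define V where "V = {x \<in> {..<T n} \<rightarrow>\<^sub>E small_ints. 0 < (\<Sum>t<T n. (x t)\<^sup>2)}"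
  define R where "R x i \<omega> = (\<Sum>t<T n. x t * X \<omega> i t)" for x i \<omega>
  define s where "s x = (\<Sum>t<T n. (x t)\<^sup>2)" for x :: "nat \<Rightarrow> real"
  define F where "F x = {\<omega>\<in>space \<Omega>. exp (4 * real n) \<le> (\<Prod>i<K n. exp ((R x i \<omega>)\<^sup>2 / (4 * s x)))}" for x
  have finV: "finite V" unfolding V_def
      by (rule finite_subset[of _ "{..<T n} \<rightarrow>\<^sub>E small_ints"]) (auto intro: finite_PiE)
  have cardV: "card V \<le> 5 ^ n"
  proof -
    have "card V \<le> card ({..<T n} \<rightarrow>\<^sub>E small_ints)"
      unfolding V_def by (intro card_mono finite_PiE) auto
    also have "\<dots> = 5 ^ T n" by (simp add: card_PiE numeral_eq_Suc)
    also have "\<dots> \<le> 5 ^ n" using T by (intro power_increasing) auto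
    finally show ?thesis .
  qed
  have F: "F x \<in> events \<and> prob (F x) \<le> 2 ^ n / exp (4 * real n)" if x: "x \<in> V" for x
  proof -
    have s: "0 < s x" using x by (simp add: V_def s_def)
    have ind: "indep_vars (\<lambda>_. borel) (R x) {..<K n}"
      unfolding R_def by (rule row_combination_indep[OF X])
    have dist: "distributed \<Omega> lborel (R x i) (normal_density 0 (sqrt (s x)))" if "i < K n" for i
      using row_combination_distributed[OF X that, of x] s by (simp add: R_def[abs_def] s_def)
    have le: "(\<integral>\<^sup>+\<omega>. ennreal (exp ((R x i \<omega>)\<^sup>2 / (4 * s x))) \<partial>\<Omega>) \<le> 2" if "i < K n" for i
      using normal_exp_square[OF dist[OF that]] s by simp
    have "(\<lambda>r. exp (r\<^sup>2 / (4 * s x))) \<in> borel_measurable borel" by measurable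
    note markov = indep_prod_markov[OF ind this _ _ le, of "exp (4 * real n)"]
    have "2 ^ K n / exp (4 * real n) \<le> 2 ^ n / exp (4 * real n)"
      using K by (intro divide_right_mono power_increasing) auto
    then show ?thesis
      using markov by (auto simp: F_def)
  qed
  \<comment> \<open>Follows from \<open>exp 1 \<ge> 5 / 2\<close>. The base 20 is
    \<open>5 * 2 * 2\<close>, for the vectors, the moment and the remaining
    \<open>1 / 2 ^ n\<close>.\<close>
  have e: "exp (4 * real n) \<ge> 20 ^ n"
  proof -
    have "(20::real) \<le> (5 / 2) ^ 4" by (simp add: power4_eq_xxxx)
    also have "\<dots> \<le> exp 1 ^ 4" using exp_lower_Taylor_quadratic[of 1] by (intro power_mono) auto
    finally have "(20::real) \<le> exp 4" by (simp flip: exp_of_nat_mult)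
    then have "20 ^ n \<le> exp (4::real) ^ n" by (intro power_mono) auto
    then show ?thesis by (simp flip: exp_of_nat_mult add: mult.commute)
  qed
  have "prob (\<Union>x\<in>V. F x) \<le> card V * (2 ^ n / exp (4 * real n))"
    using F by (intro prob_UN_le finV) auto
  also have "\<dots> \<le> 5 ^ n * (2 ^ n / 20 ^ n)"
    using of_nat_mono[OF cardV, where 'a = real] e by (intro mult_mono divide_left_mono) auto
  also have "\<dots> = 1 / 2 ^ n"
  proof -
    have "(20::real) ^ n = 5 ^ n * 2 ^ n * 2 ^ n" by (simp flip: power_mult_distrib)
    then show ?thesis by (simp add: field_simps)
  qed
  finally have "prob (\<Union>x\<in>V. F x) \<le> 1 / 2 ^ n" .
  moreover have "norm_bounded n (K n) (T n) (X \<omega>)" if \<omega>: "\<omega> \<in> space \<Omega> - (\<Union>x\<in>V. F x)" for \<omega>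
    unfolding norm_bounded_def
  proof
    fix x0 assume x0: "x0 \<in> {..<T n} \<rightarrow> small_ints"
    define x where "x = restrict x0 {..<T n}"
    note r = restrict_small_ints[OF x0, folded x_def]
    have "(\<Sum>i<K n. (R x i \<omega>)\<^sup>2) \<le> 16 * real n * s x"
    proof (cases "s x = 0")
      case True
      then have "\<forall>t<T n. x t = 0" unfolding s_def by (subst (asm) sum_nonneg_eq_0_iff) auto
      then have "R x i \<omega> = 0" for i unfolding R_def by (intro sum.neutral) auto
      then show ?thesis by (simp add: s_def sum_nonneg)
    next
      case False
      moreover have "0 \<le> s x" by (simp add: s_def sum_nonneg)
      ultimately have s: "0 < s x" by simp
      then have "x \<in> V" using r(1) by (simp add: V_def s_def)
      with \<omega> have "\<not> exp (4 * real n) \<le> exp (\<Sum>i<K n. (R x i \<omega>)\<^sup>2 / (4 * s x))"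
        by (auto simp: F_def exp_sum)
      then have "(\<Sum>i<K n. (R x i \<omega>)\<^sup>2) / (4 * s x) < 4 * real n"
        by (simp add: sum_divide_distrib)
      then show ?thesis using s by (simp add: field_simps)
    qed
    then show "(\<Sum>i<K n. (\<Sum>t<T n. x0 t * X \<omega> i t)\<^sup>2) \<le> 16 * real n * (\<Sum>t<T n. (x0 t)\<^sup>2)"
      unfolding R_def s_def r .
  qed
  ultimately show "\<exists>E\<in>events. prob E \<le> 1 / 2 ^ n \<and> (\<forall>\<omega>\<in>space \<Omega> - E. norm_bounded n (K n) (T n) (X \<omega>))"
    using F finV by (intro bexI[of _ "\<Union>x\<in>V. F x"]) auto
qed

section \<open>Anti-concentration of the row sums\<close>

definition spread :: "real \<Rightarrow> real \<Rightarrow> real \<Rightarrow> nat \<Rightarrow> nat \<Rightarrow> nat \<Rightarrow> (nat \<Rightarrow> nat \<Rightarrow> real) \<Rightarrow> bool" where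
  "spread \<delta> \<kappa> \<eta> n K T X \<longleftrightarrow> (\<forall>x\<in>{..<T} \<rightarrow> small_ints. \<kappa> * real n \<le> (\<Sum>t<T. (x t)\<^sup>2) \<longrightarrow>
     (\<forall>c. real (card {i. i < K \<and> \<bar>(\<Sum>t<T. x t * X i t) - c\<bar> \<le> \<delta> * sqrt n}) \<le> \<eta> * real n))"

text \<open>A form of \<open>spread\<close> within reach of a union bound: the real centres are
  replaced by \<open>2 * n + 1\<close> multiples of \<open>\<delta> * sqrt n\<close>, and the
  half-width is doubled so that a window whose centre is within one step of a grid point is covered
  by the window there.\<close>

definition spread_grid :: "real \<Rightarrow> real \<Rightarrow> real \<Rightarrow> nat \<Rightarrow> nat \<Rightarrow> nat \<Rightarrow> (nat \<Rightarrow> nat \<Rightarrow> real) \<Rightarrow> bool" where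
  "spread_grid \<delta> \<kappa> \<eta> n K T X \<longleftrightarrow> (\<forall>x\<in>{..<T} \<rightarrow> small_ints.
     \<kappa> * real n \<le> (\<Sum>t<T. (x t)\<^sup>2) \<longrightarrow>
     (\<forall>m\<in>{-int n..int n}.
       real (card {i. i < K \<and> \<bar>(\<Sum>t<T. x t * X i t) - m * (\<delta> * sqrt n)\<bar> \<le> 2 * (\<delta> * sqrt n)})
         \<le> \<eta> * real n))"

text \<open>Each row in the window contributes a factor \<open>b\<close> and has probability at most
  \<open>1 / b\<close> of being there, so every factor has mean at most
  \<open>1 + b * (1 / b) = 2\<close>. More than \<open>\<eta> * n\<close> rows in the window would
  push the product to \<open>b powr (\<eta> * n) = 80 ^ n\<close>, which Markov's inequality makes
  unlikely.\<close>

lemma whp_spread_grid: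
  assumes K: "\<And>n. K n \<le> n" and T: "\<And>n. T n \<le> n" and \<kappa>: "0 < \<kappa>" and \<eta>: "0 < \<eta>"
  shows "\<exists>\<delta>>0. whp (gaussian_model K T :: nat \<Rightarrow> 'a measure \<Rightarrow> _) (\<lambda>n X. spread_grid \<delta> \<kappa> \<eta> n (K n) (T n) X)"
proof -
  \<comment> \<open>Rows in the window get weight \<open>b\<close>. The union bound is over \<open>5\<^sup>n\<close> vectors and \<open>2 n + 1 \<le> 3 \<cdot> 4\<^sup>n\<close>
    windows and the weighted product has mean at most \<open>2\<^sup>n\<close>, whence the \<open>80 = 5 \<cdot> 4 \<cdot> 2 \<cdot> 2\<close>.\<close>
  define b :: real where "b = 80 powr (1 / \<eta>)"
  have b: "b \<ge> 1" unfolding b_def using \<eta> by (simp add: ge_one_powr_ge_zero)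
  \<comment> \<open>Makes the bound \<open>4 * \<delta> * sqrt n / sqrt (\<kappa> * n)\<close> on
    the probability of the doubled window equal to \<open>1 / b\<close>.\<close>
  define \<delta> where "\<delta> = sqrt \<kappa> / (4 * b)"
  have \<delta>: "\<delta> > 0" using \<kappa> b by (simp add: \<delta>_def)
  show ?thesis
  proof (rule exI[of _ \<delta>], rule conjI[OF \<delta>], rule whpI[where A = 3])
    fix n and \<Omega> :: "'a measure" and X assume H: "gaussian_model K T n \<Omega> X"
    then interpret prob_space \<Omega> by (simp add: gaussian_model_def)
    have X: "iid_gaussian_matrix \<Omega> (K n) (T n) X" using H by (simp add: gaussian_model_def)
    define w where "w = \<delta> * sqrt n"
    have w: "0 \<le> w" using \<delta> by (simp add: w_def)
    define V where "V = {x \<in> {..<T n} \<rightarrow>\<^sub>E small_ints. \<kappa> * real n \<le> (\<Sum>t<T n. (x t)\<^sup>2)}"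
    define R where "R x i \<omega> = (\<Sum>t<T n. x t * X \<omega> i t)" for x i \<omega>
    define s where "s x = (\<Sum>t<T n. (x t)\<^sup>2)" for x :: "nat \<Rightarrow> real"
    define f where "f m r = (if \<bar>r - real_of_int m * w\<bar> \<le> 2 * w then b else 1)" for m r
    define F where "F = (\<lambda>(x, m). {\<omega>\<in>space \<Omega>. 80 ^ n \<le> (\<Prod>i<K n. f m (R x i \<omega>))})"
    define W where "W = (if n = 0 then {} else V \<times> {-int n..int n})"
    have finV: "finite V" unfolding V_def
      by (rule finite_subset[of _ "{..<T n} \<rightarrow>\<^sub>E small_ints"]) (auto intro: finite_PiE)
    then have finW: "finite W" by (simp add: W_def)
    have cardV: "card V \<le> 5 ^ n"
    proof -
      have "card V \<le> card ({..<T n} \<rightarrow>\<^sub>E small_ints)"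
        unfolding V_def by (intro card_mono finite_PiE) auto
      also have "\<dots> = 5 ^ T n" by (simp add: card_PiE numeral_eq_Suc)
      also have "\<dots> \<le> 5 ^ n" using T by (intro power_increasing) auto
      finally show ?thesis .
    qed
    have "2 * n + 1 \<le> 3 * 4 ^ n" by (induction n) auto
    with cardV have "card V * (2 * n + 1) \<le> 5 ^ n * (3 * 4 ^ n)" by (rule mult_le_mono)
    moreover have "card W \<le> card V * (2 * n + 1)"
      by (simp add: W_def card_cartesian_product nat_add_distrib nat_mult_distrib)
    ultimately have "card W \<le> 5 ^ n * (3 * 4 ^ n)" by (rule le_trans[rotated])
    from of_nat_mono[OF this, where 'a = real]
    have cardW: "real (card W) \<le> 5 ^ n * (3 * 4 ^ n)" by simp
    have F: "F (x, m) \<in> events \<and> prob (F (x, m)) \<le> 2 ^ n / 80 ^ n" if xm: "(x, m) \<in> W" for x m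
    proof -
      have n: "0 < n" and x: "x \<in> V" using xm by (auto simp: W_def split: if_splits)
      have s\<kappa>: "\<kappa> * n \<le> s x" using x by (simp add: V_def s_def)
      moreover have "0 < \<kappa> * n" using n \<kappa> by simp
      ultimately have s: "0 < s x" by linarith
      have ind: "indep_vars (\<lambda>_. borel) (R x) {..<K n}"
        unfolding R_def by (rule row_combination_indep[OF X])
      have dist: "distributed \<Omega> lborel (R x i) (normal_density 0 (sqrt (s x)))" if "i < K n" for i
        using row_combination_distributed[OF X that, of x] s by (simp add: R_def[abs_def] s_def)
      have le: "(\<integral>\<^sup>+\<omega>. ennreal (f m (R x i \<omega>)) \<partial>\<Omega>) \<le> 2" if i: "i < K n" for i
      proof -
        define J where "J = {\<omega> \<in> space \<Omega>. \<bar>R x i \<omega> - real_of_int m * w\<bar> \<le> 2 * w}"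
        have [measurable]: "R x i \<in> borel_measurable \<Omega>" using distributed_measurable[OF dist[OF i]] by simp
        have J: "J \<in> events" unfolding J_def by measurable
        have "emeasure \<Omega> J \<le> ennreal (2 * (2 * w) / sqrt (s x))"
          unfolding J_def by (rule normal_window[OF dist[OF i]]) (use s w in auto)
        also have "\<dots> \<le> ennreal (1 / b)"
        proof (rule ennreal_leI)
          have "sqrt \<kappa> * sqrt n \<le> sqrt (s x)" using s\<kappa> by (simp flip: real_sqrt_mult)
          then show "2 * (2 * w) / sqrt (s x) \<le> 1 / b"
            using s b by (simp add: w_def \<delta>_def divide_simps)
        qed
        finally have J1: "emeasure \<Omega> J \<le> ennreal (1 / b)" .
        have "(\<integral>\<^sup>+\<omega>. ennreal (f m (R x i \<omega>)) \<partial>\<Omega>) \<le> (\<integral>\<^sup>+\<omega>. 1 + ennreal b * indicator J \<omega> \<partial>\<Omega>)"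
          by (intro nn_integral_mono) (use b in \<open>auto simp: f_def J_def indicator_def intro: add_increasing\<close>)
        also have "\<dots> = 1 + ennreal b * emeasure \<Omega> J"
          using J by (subst nn_integral_add) (auto simp: nn_integral_cmult_indicator emeasure_space_1)
        also have "\<dots> \<le> 1 + ennreal b * ennreal (1 / b)"
          by (intro add_left_mono mult_left_mono J1) auto
        also have "\<dots> = 2" using b by (simp flip: ennreal_mult')
        finally show ?thesis .
      qed
      have f: "f m \<in> borel_measurable borel" unfolding f_def by measurable
      note markov = indep_prod_markov[OF ind f _ _ le, of "80 ^ n"]
      have f0: "0 \<le> f m r" for r using b by (simp add: f_def)
      have "2 ^ K n / 80 ^ n \<le> (2 ^ n / 80 ^ n :: real)"
        using K by (intro divide_right_mono power_increasing) auto
      then show ?thesis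
        using markov f0 by (auto simp: F_def)
    qed
    have "prob (\<Union>p\<in>W. F p) \<le> card W * (2 ^ n / 80 ^ n)"
      using F by (intro prob_UN_le finW) auto
    also have "\<dots> \<le> (5 ^ n * (3 * 4 ^ n)) * (2 ^ n / 80 ^ n)"
      using cardW by (intro mult_right_mono) auto
    also have "\<dots> = 3 / 2 ^ n"
    proof -
      have "(80::real) ^ n = 5 ^ n * 4 ^ n * 2 ^ n * 2 ^ n" by (simp flip: power_mult_distrib)
      then show ?thesis by (simp add: field_simps)
    qed
    finally have "prob (\<Union>p\<in>W. F p) \<le> 3 / 2 ^ n" .
    moreover have "card {i. i < K n \<and> \<bar>(\<Sum>t<T n. x0 t * X \<omega> i t) - m * (\<delta> * sqrt n)\<bar> \<le> 2 * (\<delta> * sqrt n)} \<le> \<eta> * real n"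
      if \<omega>: "\<omega> \<in> space \<Omega> - (\<Union>p\<in>W. F p)" and x0: "x0 \<in> {..<T n} \<rightarrow> small_ints"
        and x0\<kappa>: "\<kappa> * real n \<le> (\<Sum>t<T n. (x0 t)\<^sup>2)" and m: "m \<in> {-int n..int n}" for \<omega> x0 m
    proof -
      define x where "x = restrict x0 {..<T n}"
      note r = restrict_small_ints[OF x0, folded x_def]
      define D where "D = {i. i < K n \<and> \<bar>R x i \<omega> - m * w\<bar> \<le> 2 * w}"
      have "card D \<le> \<eta> * real n"
      proof (cases "n = 0")
        case True
        then show ?thesis using K[of 0] by (simp add: D_def)
      next
        case False
        have "x \<in> V" using r(1) x0\<kappa> unfolding V_def r(3)[symmetric] by simp
        then have "(x, m) \<in> W" using m False by (simp add: W_def)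
        with \<omega> have "\<not> 80 ^ n \<le> (\<Prod>i<K n. f m (R x i \<omega>))" by (auto simp: F_def)
        moreover have "(\<Prod>i<K n. f m (R x i \<omega>)) = b ^ card D"
        proof -
          have "(\<Prod>i<K n. f m (R x i \<omega>)) = (\<Prod>i\<in>D. b)"
            unfolding D_def by (rule prod.mono_neutral_cong_right) (auto simp: f_def)
          then show ?thesis by simp
        qed
        moreover have "80 ^ n = b powr (\<eta> * n)"
          using \<eta> by (simp add: b_def powr_powr powr_realpow)
        moreover have "b ^ card D = b powr (card D)"
          using b by (simp add: powr_realpow)
        ultimately have "b powr (card D) < b powr (\<eta> * n)" by simp
        moreover have "b powr (\<eta> * n) \<le> b powr (card D)" if "\<eta> * n \<le> card D"
          using that b by (intro powr_mono) auto
        ultimately show ?thesis by linarith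
      qed
      then show ?thesis unfolding D_def R_def r w_def .
    qed
    ultimately show "\<exists>E\<in>events. prob E \<le> 3 / 2 ^ n \<and> (\<forall>\<omega>\<in>space \<Omega> - E.
       spread_grid \<delta> \<kappa> \<eta> n (K n) (T n) (X \<omega>))"
      unfolding spread_grid_def using F finW by (intro bexI[of _ "\<Union>p\<in>W. F p"]) auto
  qed
qed

text \<open>The norm bound confines every row sum to an interval of length of order
  \<open>n\<close>, so a window that contains a row sum has its centre within the extent of the
  grid, which is of order \<open>n * sqrt n\<close>.\<close>

lemma whp_spread:
  assumes K: "\<And>n. K n \<le> n" and T: "\<And>n. T n \<le> n" and \<kappa>: "0 < \<kappa>" and \<eta>: "0 < \<eta>"
  shows "\<exists>\<delta>>0. whp (gaussian_model K T :: nat \<Rightarrow> 'a measure \<Rightarrow> _) (\<lambda>n X. spread \<delta> \<kappa> \<eta> n (K n) (T n) X)"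
proof -
  obtain \<delta> where \<delta>: "\<delta> > 0" and grid: "whp (gaussian_model K T :: nat \<Rightarrow> 'a measure \<Rightarrow> _) (\<lambda>n X. spread_grid \<delta> \<kappa> \<eta> n (K n) (T n) X)"
    using whp_spread_grid[OF K T \<kappa> \<eta>] by blast
  \<comment> \<open>Puts \<open>c / w\<close> within \<open>n - 1\<close> of 0 for every nonempty
    window; the 2 pays for the half-width of the window and for rounding the centre to the
    grid.\<close>
  have ev: "\<forall>\<^sub>F n in sequentially. 8 * real n / (\<delta> * sqrt n) + 2 \<le> n"
    using \<delta> by real_asymp
  have "whp (gaussian_model K T :: nat \<Rightarrow> 'a measure \<Rightarrow> _) (\<lambda>n X. spread \<delta> \<kappa> \<eta> n (K n) (T n) X)"
  proof (rule whp_mono[OF whp_conj[OF grid whp_norm_bounded[OF K T]]])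
    show "\<forall>\<^sub>F n in sequentially. \<forall>X.
      spread_grid \<delta> \<kappa> \<eta> n (K n) (T n) X \<and>
      norm_bounded n (K n) (T n) X \<longrightarrow> spread \<delta> \<kappa> \<eta> n (K n) (T n) X"
      using ev eventually_gt_at_top[of 0]
    proof eventually_elim
      case (elim n)
      show ?case unfolding spread_def
      proof (intro allI impI ballI, elim conjE)
        fix X x c
        assume grid: "spread_grid \<delta> \<kappa> \<eta> n (K n) (T n) X"
          and nb: "norm_bounded n (K n) (T n) X"
          and x: "x \<in> {..<T n} \<rightarrow> small_ints" and x\<kappa>: "\<kappa> * real n \<le> (\<Sum>t<T n. (x t)\<^sup>2)"
        define R where "R i = (\<Sum>t<T n. x t * X i t)" for i
        define w where "w = \<delta> * sqrt n"
        have w: "0 < w" using \<delta> elim by (simp add: w_def)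
        \<comment> \<open>The squared norm of \<open>x\<close> is at most \<open>4 * n\<close>, so
          the norm bound gives \<open>64 * n\<^sup>2\<close> for the square.\<close>
        have R: "\<bar>R i\<bar> \<le> 8 * real n" if "i < K n" for i
        proof -
          have "(R i)\<^sup>2 \<le> (\<Sum>i<K n. (R i)\<^sup>2)"
            by (rule member_le_sum) (use that in auto)
          also have "\<dots> \<le> 16 * real n * (\<Sum>t<T n. (x t)\<^sup>2)"
            using nb x by (simp add: norm_bounded_def R_def)
          also have "(\<Sum>t<T n. (x t)\<^sup>2) \<le> (\<Sum>t<T n. 4)"
            by (rule sum_mono) (use x in \<open>force simp: Pi_iff\<close>)
          also have "16 * real n * (\<Sum>t<T n. 4) \<le> 16 * real n * (4 * real n)"
            using T[of n] by (intro mult_left_mono) auto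
          finally have "(R i)\<^sup>2 \<le> (8 * real n)\<^sup>2"
            by (simp add: power2_eq_square mult_left_mono)
          then show ?thesis using abs_le_square_iff[of "R i" "8 * real n"] by simp
        qed
        have "real (card {i. i < K n \<and> \<bar>R i - c\<bar> \<le> w}) \<le> \<eta> * real n"
        proof (cases "{i. i < K n \<and> \<bar>R i - c\<bar> \<le> w} = {}")
          case True
          then show ?thesis using \<eta> by (simp only: True) simp
        next
          case False
          then obtain i where "i < K n" "\<bar>R i - c\<bar> \<le> w" by auto
          then have "\<bar>c\<bar> \<le> 8 * real n + w" using R[of i] by linarith
          then have "\<bar>c / w\<bar> \<le> 8 * real n / w + 1" using w by (simp add: field_simps)
          then have cw: "\<bar>c / w\<bar> \<le> real n - 1" using elim(1) by (simp add: w_def)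
          \<comment> \<open>Rounding moves the centre by at most \<open>w\<close>, which the doubled
            half-width absorbs.\<close>
          define m where "m = \<lfloor>c / w\<rfloor>"
          have m: "m \<in> {-int n..int n}" using abs_le_D1[OF cw] abs_le_D2[OF cw]
            unfolding m_def atLeastAtMost_iff by (intro conjI; linarith)
          have "\<bar>c / w - m\<bar> \<le> 1" unfolding m_def by linarith
          then have "\<bar>c / w - m\<bar> * w \<le> 1 * w" using w by (intro mult_right_mono) auto
          moreover have "c - m * w = (c / w - m) * w" using w by (simp add: field_simps)
          ultimately have cm: "\<bar>c - m * w\<bar> \<le> w" using w by (simp add: abs_mult)
          have "card {i. i < K n \<and> \<bar>R i - c\<bar> \<le> w} \<le> card {i. i < K n \<and> \<bar>R i - m * w\<bar> \<le> 2 * w}"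
            by (intro card_mono) (use cm in auto)
          moreover have "real (card {i. i < K n \<and> \<bar>R i - m * w\<bar> \<le> 2 * w}) \<le> \<eta> * real n"
            using grid x x\<kappa> m unfolding spread_grid_def R_def w_def by blast
          ultimately show ?thesis by linarith
        qed
        then show "real (card {i. i < K n \<and> \<bar>(\<Sum>t<T n. x t * X i t) - c\<bar> \<le> \<delta> * sqrt n}) \<le> \<eta> * real n"
          by (simp add: R_def w_def)
      qed
    qed
  qed
  with \<delta> show ?thesis by blast
qed

section \<open>Deterministic stability of a round\<close>

lemma sum_square_mismatch_le:
  fixes x y :: "nat \<Rightarrow> real"
  assumes "x \<in> {..<T} \<rightarrow> {-1, 0, 1}" "y \<in> {..<T} \<rightarrow> {-1, 0, 1}"
  shows "(\<Sum>t<T. (x t - y t)\<^sup>2) \<le> 4 * real (card {t. t < T \<and> x t \<noteq> y t})"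
proof -
  have "(\<Sum>t<T. (x t - y t)\<^sup>2) = (\<Sum>t | t < T \<and> x t \<noteq> y t. (x t - y t)\<^sup>2)"
    by (rule sum.mono_neutral_right) auto
  also have "\<dots> \<le> (\<Sum>t | t < T \<and> x t \<noteq> y t. 4)"
  proof (rule sum_mono)
    fix t assume "t \<in> {t. t < T \<and> x t \<noteq> y t}"
    with assms have "x t \<in> {-1, 0, 1}" "y t \<in> {-1, 0, 1}" by auto
    then show "(x t - y t)\<^sup>2 \<le> 4" by auto
  qed
  finally show ?thesis by simp
qed

text \<open>The difference of the row sums is
  \<open>X (x - y) + (1 - cos \<tau>) X y - sin \<tau> Y y\<close>. The entries of
  \<open>x - y\<close> lie in \<open>small_ints\<close>, so \<open>norm_bounded\<close> controls
  each of the three terms, however \<open>x\<close> and \<open>y\<close> depend on the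
  matrices.\<close>

lemma norm_bounded_interpolate:
  assumes X: "norm_bounded n K T X" and Y: "norm_bounded n K T Y" and T: "T \<le> n"
    and x: "x \<in> {..<T} \<rightarrow> {-1, 0, 1}" and y: "y \<in> {..<T} \<rightarrow> {-1, 0, 1}"
  shows "(\<Sum>i<K. ((\<Sum>t<T. x t * X i t) - (\<Sum>t<T. y t * interpolate \<tau> X Y i t))\<^sup>2)
    \<le> 192 * real n * (real (card {t. t < T \<and> x t \<noteq> y t}) + \<tau>\<^sup>2 * real n)"
proof -
  define d where "d = real (card {t. t < T \<and> x t \<noteq> y t})"
  define a where "a i = (\<Sum>t<T. (x t - y t) * X i t)" for i
  define u where "u i = (\<Sum>t<T. y t * X i t)" for i
  define v where "v i = (\<Sum>t<T. y t * Y i t)" for i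
  have yn: "(\<Sum>t<T. (y t)\<^sup>2) \<le> real n"
  proof -
    have "(\<Sum>t<T. (y t)\<^sup>2) \<le> (\<Sum>t<T. 1)"
    proof (rule sum_mono)
      fix t assume "t \<in> {..<T}"
      with y have "y t \<in> {-1, 0, 1}" by auto
      then show "(y t)\<^sup>2 \<le> 1" by auto
    qed
    with T show ?thesis by simp
  qed
  have "(\<lambda>t. x t - y t) \<in> {..<T} \<rightarrow> small_ints"
  proof
    fix t assume "t \<in> {..<T}"
    with x y have "x t \<in> {-1, 0, 1}" "y t \<in> {-1, 0, 1}" by auto
    then show "x t - y t \<in> small_ints" by auto
  qed
  then have "(\<Sum>i<K. (a i)\<^sup>2) \<le> 16 * real n * (\<Sum>t<T. (x t - y t)\<^sup>2)"
    using X unfolding norm_bounded_def a_def by (rule bspec[rotated])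
  also have "\<dots> \<le> 16 * real n * (4 * d)"
    unfolding d_def by (intro mult_left_mono sum_square_mismatch_le x y) auto
  finally have a: "(\<Sum>i<K. (a i)\<^sup>2) \<le> 64 * real n * d" by simp
  have y': "y \<in> {..<T} \<rightarrow> small_ints" using y by auto
  have yn': "16 * real n * (\<Sum>t<T. (y t)\<^sup>2) \<le> 16 * real n * real n"
    using yn by (intro mult_left_mono) auto
  have u: "(\<Sum>i<K. (u i)\<^sup>2) \<le> 16 * real n * real n"
    using X y' yn' unfolding norm_bounded_def u_def by (meson order_trans)
  have v: "(\<Sum>i<K. (v i)\<^sup>2) \<le> 16 * real n * real n"
    using Y y' yn' unfolding norm_bounded_def v_def by (meson order_trans)
  \<comment> \<open>A crude linear bound, which brings the cosine term to the same order as the sine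
    term.\<close>
  have cos: "(1 - cos \<tau>)\<^sup>2 \<le> \<tau>\<^sup>2"
  proof -
    have "1 - cos \<tau> = 2 * (sin (\<tau> / 2))\<^sup>2" using cos_double_sin[of "\<tau> / 2"] by simp
    moreover have "(sin (\<tau> / 2))\<^sup>2 \<le> \<bar>sin (\<tau> / 2)\<bar>"
      using abs_sin_le_one[of "\<tau> / 2"] by (metis abs_ge_zero mult_left_le power2_abs power2_eq_square)
    moreover have "\<bar>sin (\<tau> / 2)\<bar> \<le> \<bar>\<tau> / 2\<bar>" by (rule abs_sin_x_le_abs_x)
    ultimately have "\<bar>1 - cos \<tau>\<bar> \<le> \<bar>\<tau>\<bar>" by simp
    then show ?thesis by (simp only: abs_le_square_iff)
  qed
  have sin: "(sin \<tau>)\<^sup>2 \<le> \<tau>\<^sup>2"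
    using abs_sin_x_le_abs_x[of \<tau>] by (simp add: abs_le_square_iff)
  have sq3: "(p + q - r)\<^sup>2 \<le> 3 * (p\<^sup>2 + q\<^sup>2 + r\<^sup>2)" for p q r :: real
  proof -
    have "3 * (p\<^sup>2 + q\<^sup>2 + r\<^sup>2) - (p + q - r)\<^sup>2 = (p - q)\<^sup>2 + (p + r)\<^sup>2 + (q + r)\<^sup>2"
      by (simp add: power2_eq_square algebra_simps)
    then show ?thesis by (smt (verit) zero_le_power2)
  qed
  have "((\<Sum>t<T. x t * X i t) - (\<Sum>t<T. y t * interpolate \<tau> X Y i t))\<^sup>2
      \<le> 3 * ((a i)\<^sup>2 + \<tau>\<^sup>2 * (u i)\<^sup>2 + \<tau>\<^sup>2 * (v i)\<^sup>2)" for i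
  proof -
    have "(\<Sum>t<T. x t * X i t) - (\<Sum>t<T. y t * interpolate \<tau> X Y i t)
        = a i + (1 - cos \<tau>) * u i - sin \<tau> * v i"
      by (simp add: a_def u_def v_def interpolate_def sum_distrib_left algebra_simps sum.distrib sum_subtractf)
    then have "((\<Sum>t<T. x t * X i t) - (\<Sum>t<T. y t * interpolate \<tau> X Y i t))\<^sup>2
        \<le> 3 * ((a i)\<^sup>2 + (1 - cos \<tau>)\<^sup>2 * (u i)\<^sup>2 + (sin \<tau>)\<^sup>2 * (v i)\<^sup>2)"
      using sq3[of "a i" "(1 - cos \<tau>) * u i" "sin \<tau> * v i"] by (simp add: power_mult_distrib)
    also have "\<dots> \<le> 3 * ((a i)\<^sup>2 + \<tau>\<^sup>2 * (u i)\<^sup>2 + \<tau>\<^sup>2 * (v i)\<^sup>2)"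
      using cos sin by (intro mult_left_mono add_mono mult_right_mono) auto
    finally show ?thesis .
  qed
  then have "(\<Sum>i<K. ((\<Sum>t<T. x t * X i t) - (\<Sum>t<T. y t * interpolate \<tau> X Y i t))\<^sup>2)
      \<le> (\<Sum>i<K. 3 * ((a i)\<^sup>2 + \<tau>\<^sup>2 * (u i)\<^sup>2 + \<tau>\<^sup>2 * (v i)\<^sup>2))"
    by (intro sum_mono)
  also have "\<dots> = 3 * ((\<Sum>i<K. (a i)\<^sup>2) + \<tau>\<^sup>2 * (\<Sum>i<K. (u i)\<^sup>2) + \<tau>\<^sup>2 * (\<Sum>i<K. (v i)\<^sup>2))"
    by (simp add: sum_distrib_left[symmetric] sum.distrib)
  also have "\<dots> \<le> 3 * (64 * real n * d + \<tau>\<^sup>2 * (16 * real n * real n) + \<tau>\<^sup>2 * (16 * real n * real n))"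
    using a u v by (intro mult_left_mono add_mono) auto
  \<comment> \<open>The factor 192 is \<open>3 * 16 * 4\<close>: three terms, the norm bound, and at
    most 4 per mismatch.\<close>
  also have "\<dots> \<le> 192 * real n * (d + \<tau>\<^sup>2 * real n)"
    by (simp add: algebra_simps)
  finally show ?thesis by (simp add: d_def)
qed

section \<open>Counting the coordinates affected by a small perturbation\<close>

lemma card_large_le:
  fixes z :: "nat \<Rightarrow> real"
  assumes "(\<Sum>i<K. (z i)\<^sup>2) \<le> R" and w: "0 < w"
  shows "real (card {i. i < K \<and> w < \<bar>z i\<bar>}) \<le> R / w\<^sup>2"
proof -
  have "real (card {i. i < K \<and> w < \<bar>z i\<bar>}) * w\<^sup>2 = (\<Sum>i | i < K \<and> w < \<bar>z i\<bar>. w\<^sup>2)" by simp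
  also have "\<dots> \<le> (\<Sum>i | i < K \<and> w < \<bar>z i\<bar>. (z i)\<^sup>2)"
    using w by (intro sum_mono) (auto simp: abs_le_square_iff[symmetric])
  also have "\<dots> \<le> (\<Sum>i<K. (z i)\<^sup>2)" by (rule sum_mono2) auto
  also have "\<dots> \<le> R" by fact
  finally show ?thesis using w by (simp add: field_simps)
qed

text \<open>A sign can change only where \<open>p\<close> lies within \<open>w\<close> of 0 or where
  \<open>p\<close> and \<open>q\<close> differ by more than \<open>w\<close>; the first set is
  bounded by hypothesis, the second by Chebyshev's inequality.\<close>

lemma sgn_pm_stable:
  fixes p q :: "nat \<Rightarrow> real"
  assumes R: "(\<Sum>t<T. (p t - q t)\<^sup>2) \<le> R" and w: "0 < w"
    and b: "real (card {t. t < T \<and> \<bar>p t\<bar> \<le> w}) \<le> b"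
  shows "real (card {t. t < T \<and> sgn_pm (p t) \<noteq> sgn_pm (q t)}) \<le> R / w\<^sup>2 + b"
proof -
  have "{t. t < T \<and> sgn_pm (p t) \<noteq> sgn_pm (q t)}
      \<subseteq> {t. t < T \<and> w < \<bar>p t - q t\<bar>} \<union> {t. t < T \<and> \<bar>p t\<bar> \<le> w}"
    by (auto simp: sgn_pm_def split: if_splits)
  then have "card {t. t < T \<and> sgn_pm (p t) \<noteq> sgn_pm (q t)}
      \<le> card ({t. t < T \<and> w < \<bar>p t - q t\<bar>} \<union> {t. t < T \<and> \<bar>p t\<bar> \<le> w})"
    by (intro card_mono) auto
  also have "\<dots> \<le> card {t. t < T \<and> w < \<bar>p t - q t\<bar>} + card {t. t < T \<and> \<bar>p t\<bar> \<le> w}"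
    by (rule card_Un_le)
  finally show ?thesis using card_large_le[OF R w] b by linarith
qed

text \<open>Otherwise every index ranked before \<open>i'\<close> would be ranked before
  \<open>i\<close> as well, so the rank of \<open>i'\<close> would be below \<open>m\<close>
  too.\<close>

lemma smallest_indices_le:
  assumes "i \<in> smallest_indices k m p" "i' < k" "i' \<notin> smallest_indices k m p"
  shows "p i \<le> p i'"
proof (rule ccontr)
  assume "\<not> p i \<le> p i'"
  then have "card {l. l < k \<and> (p l < p i' \<or> p l = p i' \<and> l < i')} \<le> card {l. l < k \<and> (p l < p i \<or> p l = p i \<and> l < i)}"
    by (intro card_mono) auto
  with assms show False by (auto simp: smallest_indices_def)
qed

text \<open>Both selections have the same size, so it suffices to count the indices lost. If every
  index gained has moved by more than \<open>w / 2\<close>, there are few. Otherwise some gained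
  \<open>l\<close> has hardly moved and serves as a threshold: an index lost is not above
  \<open>l\<close> under \<open>p\<close> and not below it under \<open>q\<close>, so it has moved
  by more than \<open>w / 2\<close> or its value under \<open>p\<close> is within \<open>w\<close>
  of \<open>p l\<close>.\<close>

lemma smallest_indices_stable:
  fixes p q :: "nat \<Rightarrow> real"
  assumes R: "(\<Sum>i<k. (p i - q i)\<^sup>2) \<le> R" and w: "0 < w"
    and b: "\<And>c. real (card {i. i < k \<and> \<bar>p i - c\<bar> \<le> w}) \<le> b"
  shows "real (card {i. i < k \<and> (i \<in> smallest_indices k m p) \<noteq> (i \<in> smallest_indices k m q)})
    \<le> 2 * (4 * R / w\<^sup>2 + b)"
proof -
  define I where "I = smallest_indices k m p"
  define J where "J = smallest_indices k m q"
  define D where "D = {i. i < k \<and> w / 2 < \<bar>p i - q i\<bar>}"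
  have I: "I \<subseteq> {..<k}" and J: "J \<subseteq> {..<k}" by (auto simp: I_def J_def smallest_indices_def)
  then have fin: "finite I" "finite J" "finite D" by (auto intro: finite_subset simp: D_def)
  have D: "real (card D) \<le> 4 * R / w\<^sup>2"
  proof -
    have "real (card D) \<le> R / (w / 2)\<^sup>2"
      unfolding D_def using w by (intro card_large_le[OF R]) simp
    also have "\<dots> = 4 * R / w\<^sup>2" using w by (simp add: field_simps)
    finally show ?thesis .
  qed
  have same: "card (I - J) = card (J - I)"
    using card_smallest_indices[of k m p] card_smallest_indices[of k m q] fin
    by (simp add: card_Diff_subset_Int Int_commute I_def J_def)
  have main: "real (card (I - J)) \<le> 4 * R / w\<^sup>2 + b"
  proof (cases "J - I \<subseteq> D")
    case True
    then have "card (J - I) \<le> card D" by (intro card_mono fin)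
    moreover have "0 \<le> b" using b[of 0] by linarith
    ultimately show ?thesis using D same by linarith
  next
    case False
    then obtain l where l: "l \<in> J" "l \<notin> I" "l \<notin> D" by auto
    have "I - J \<subseteq> D \<union> {i. i < k \<and> \<bar>p i - p l\<bar> \<le> w}"
    proof
      fix i assume i: "i \<in> I - J"
      have "l < k" "i < k" using l i I J by auto
      then have "p i \<le> p l" "q l \<le> q i"
        using l i smallest_indices_le[of i k m p l] smallest_indices_le[of l k m q i]
        by (auto simp: I_def J_def)
      moreover have "\<not> w / 2 < \<bar>p l - q l\<bar>" using l(3) \<open>l < k\<close> by (simp add: D_def)
      ultimately have "w / 2 < \<bar>p i - q i\<bar> \<or> \<bar>p i - p l\<bar> \<le> w" by linarith
      then show "i \<in> D \<union> {i. i < k \<and> \<bar>p i - p l\<bar> \<le> w}" using \<open>i < k\<close> by (auto simp: D_def)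
    qed
    then have "card (I - J) \<le> card (D \<union> {i. i < k \<and> \<bar>p i - p l\<bar> \<le> w})"
      by (intro card_mono) (use fin in auto)
    also have "\<dots> \<le> card D + card {i. i < k \<and> \<bar>p i - p l\<bar> \<le> w}" by (rule card_Un_le)
    finally show ?thesis using D b[of "p l"] by linarith
  qed
  have "{i. i < k \<and> (i \<in> I) \<noteq> (i \<in> J)} = (I - J) \<union> (J - I)" using I J by auto
  then have "card {i. i < k \<and> (i \<in> I) \<noteq> (i \<in> J)} \<le> card (I - J) + card (J - I)"
    by (simp add: card_Un_le)
  then have "real (card {i. i < k \<and> (i \<in> I) \<noteq> (i \<in> J)}) \<le> 2 * real (card (I - J))"
    using same by linarith
  also have "\<dots> \<le> 2 * (4 * R / w\<^sup>2 + b)" using main by (intro mult_left_mono) auto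
  finally show ?thesis by (simp only: I_def J_def)
qed

section \<open>The rounds of the algorithm\<close>

text \<open>Round 0 counts as selecting every row, so that all rounds take signs of column sums over
  a selected set.\<close>

definition kr_rows :: "real \<Rightarrow> nat \<Rightarrow> nat \<Rightarrow> (nat \<Rightarrow> nat \<Rightarrow> real) \<Rightarrow> nat \<Rightarrow> nat set" where
  "kr_rows C k n M j = (case j of 0 \<Rightarrow> {..<k}
     | Suc j' \<Rightarrow> smallest_indices k (kr_k k n j) (\<lambda>i. \<Sum>t<kr_S C n j'. M i t * kr_sigma C k n M j' t))"

lemma kr_rows_subset: "kr_rows C k n M j \<subseteq> {..<k}"
  by (auto simp: kr_rows_def smallest_indices_def split: nat.split)

lemma kr_sigma_0: "t < kr_S C n 0 \<Longrightarrow> kr_sigma C k n M 0 t = sgn_pm (\<Sum>i\<in>kr_rows C k n M 0. M i t)"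
  by (simp add: kr_rows_def)

lemma kr_sigma_Suc:
  "kr_sigma C k n M (Suc j) t =
     (if kr_S C n j \<le> t \<and> t < kr_S C n (Suc j) then sgn_pm (\<Sum>i\<in>kr_rows C k n M (Suc j). M i t)
      else kr_sigma C k n M j t)"
  by (simp add: kr_rows_def Let_def)

lemma kr_S_mono: "i \<le> j \<Longrightarrow> kr_S C n i \<le> kr_S C n j"
  unfolding kr_S_def by (rule sum_mono2) auto

lemma kr_S_le: "j \<le> kr_N C n \<Longrightarrow> kr_S C n j \<le> n"
  using kr_S_mono[of j "kr_N C n" C n] by (simp add: kr_S_final)

lemma kr_sigma_stable:
  assumes "i \<le> j" "t < kr_S C n i"
  shows "kr_sigma C k n M j t = kr_sigma C k n M i t"
  using assms(1)
proof (induction rule: dec_induct)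
  case (step j)
  have "kr_S C n i \<le> kr_S C n j" by (rule kr_S_mono) (use step in auto)
  with step assms(2) show ?case by (simp add: kr_sigma_Suc del: kr_sigma.simps)
qed auto

section \<open>Sizes of the rounds and of the selected sets\<close>

lemma kr_f_le: "kr_f j \<le> 1 / 2 ^ j"
proof -
  have "(2::real) ^ j \<le> 10 ^ (2 ^ j)"
  proof -
    have "(2::real) ^ j \<le> 2 ^ (2 ^ j)" by (intro power_increasing) (auto simp: less_imp_le)
    also have "\<dots> \<le> 10 ^ (2 ^ j)" by (intro power_mono) auto
    finally show ?thesis .
  qed
  then have "1 / (10::real) ^ (2 ^ j) \<le> 1 / 2 ^ j" by (intro divide_left_mono) auto
  then show ?thesis by (auto simp: kr_f_def)
qed

lemma kr_A_ge_1: "1 \<le> kr_A C n"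
proof -
  have "(\<Sum>j\<in>{0}. kr_f j) \<le> kr_A C n"
    unfolding kr_A_def by (rule sum_mono2) (auto simp: kr_f_pos less_imp_le)
  then show ?thesis by (simp add: kr_f_def)
qed

lemma sum_kr_f_tail: "(\<Sum>j = Suc J..N. kr_f j) \<le> 1 / 2 ^ J"
proof (cases "J \<le> N")
  case True
  \<comment> \<open>The subtracted term \<open>1 / 2 ^ N\<close> makes the induction close.\<close>
  have "(\<Sum>j = Suc J..N. kr_f j) \<le> 1 / 2 ^ J - 1 / 2 ^ N"
    using True
  proof (induction N rule: dec_induct)
    case (step N)
    then show ?case using kr_f_le[of "Suc N"] by simp
  qed simp
  then show ?thesis by (smt (verit) divide_nonneg_nonneg zero_le_power)
qed simp

lemma kr_A_le_2: "kr_A C n \<le> 2"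
proof -
  have "kr_A C n = kr_f 0 + (\<Sum>j = Suc 0..kr_N C n. kr_f j)"
    unfolding kr_A_def by (simp add: atMost_atLeast0 sum.atLeast_Suc_atMost)
  with sum_kr_f_tail[of 0 "kr_N C n"] show ?thesis by (simp add: kr_f_def)
qed

text \<open>Round 0 alone assigns a fraction \<open>1 / kr_A C n\<close> of the coordinates, and
  \<open>kr_A C n \<le> 2\<close>. Hence every partial assignment has squared norm of order
  \<open>n\<close>, as \<open>spread\<close> demands.\<close>

lemma kr_S_ge: "real n / 2 - 1 \<le> real (kr_S C n j)"
proof -
  have "real n / 2 \<le> real n / kr_A C n"
    using kr_A_le_2[of C n] kr_A_pos[of C n] by (intro divide_left_mono) auto
  moreover have "int (kr_S C n 0) = \<lfloor>real n / kr_A C n\<rfloor>"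
    using kr_S_eq[of C n 0] by (simp add: kr_f_def)
  moreover have "kr_S C n 0 \<le> kr_S C n j" by (rule kr_S_mono) simp
  ultimately show ?thesis by linarith
qed

text \<open>The rounds after \<open>J\<close> share a fraction of \<open>n\<close> equal to the tail
  of \<open>kr_f\<close> divided by \<open>kr_A C n \<ge> 1\<close>; the added 1 comes from the
  floor.\<close>

lemma kr_S_tail:
  assumes "J \<le> kr_N C n"
  shows "real n - real (kr_S C n J) \<le> real n / 2 ^ J + 1"
proof -
  have "kr_A C n = (\<Sum>i\<le>J. kr_f i) + (\<Sum>j = Suc J..kr_N C n. kr_f j)"
  proof -
    have "{..kr_N C n} = {..J} \<union> {Suc J..kr_N C n}" using assms by auto
    then show ?thesis unfolding kr_A_def by (simp add: sum.union_disjoint disjoint_iff)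
  qed
  then have "(\<Sum>i\<le>J. kr_f i) \<ge> kr_A C n - 1 / 2 ^ J" using sum_kr_f_tail[of J "kr_N C n"] by linarith
  then have "real n / kr_A C n * (\<Sum>i\<le>J. kr_f i) \<ge> real n / kr_A C n * (kr_A C n - 1 / 2 ^ J)"
    using kr_A_pos[of C n] by (intro mult_left_mono) auto
  also have "real n / kr_A C n * (kr_A C n - 1 / 2 ^ J) = real n - real n / kr_A C n / 2 ^ J"
    using kr_A_pos[of C n] by (simp add: field_simps)
  finally have "real n - real n / kr_A C n / 2 ^ J \<le> real n / kr_A C n * (\<Sum>i\<le>J. kr_f i)" .
  moreover have "real n / kr_A C n / 2 ^ J \<le> real n / 2 ^ J"
    using kr_A_ge_1[of C n] kr_A_pos[of C n] by (intro divide_right_mono) (auto simp: divide_le_eq mult_le_cancel_left1)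
  ultimately show ?thesis using kr_S_eq[of C n J] by linarith
qed

text \<open>Guarantees that a fixed round \<open>J\<close> is actually carried out, so that
  \<open>kr_S C n J\<close> is at most \<open>n\<close>.\<close>

lemma kr_N_tendsto:
  assumes "0 < C"
  shows "\<forall>\<^sub>F n in sequentially. J \<le> kr_N C n"
proof -
  have "\<forall>\<^sub>F n in sequentially. real J \<le> C * log 10 (log 10 (real n))"
    using assms unfolding log_def by real_asymp
  then show ?thesis
    by eventually_elim (simp add: kr_N_def le_nat_iff le_ceiling_iff)
qed

text \<open>Supplies the lower bound on the squared norm of the indicator of the selected rows that
  \<open>spread\<close> demands; the constant may depend on the round.\<close>

lemma kr_rows_card:
  assumes \<alpha>: "0 < \<alpha>"
  shows "\<exists>\<kappa>>0. \<forall>\<^sub>F n in sequentially. \<forall>M. \<kappa> * real n \<le> real (card (kr_rows C (nat \<lfloor>\<alpha> * real n\<rfloor>) n M j))"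
proof -
  \<comment> \<open>For \<open>j \<ge> 1\<close>, \<open>kr_k k n j\<close> is at least
    \<open>c * n - 1\<close>; for \<open>j = 0\<close> the value is 1.\<close>
  define c where "c = (if j = 1 then 1 / 10 ^ 8 else kr_f j ^ 3)"
  have c: "0 < c" by (simp add: c_def kr_f_pos)
  \<comment> \<open>Half the rate leaves room for the loss of 1 in each floor once
    \<open>\<kappa> * n \<ge> 1\<close>.\<close>
  define \<kappa> where "\<kappa> = min \<alpha> c / 2"
  have \<kappa>: "0 < \<kappa>" "2 * \<kappa> \<le> \<alpha>" "2 * \<kappa> \<le> c" using c \<alpha> by (auto simp: \<kappa>_def)
  have "\<forall>\<^sub>F n in sequentially. 1 \<le> \<kappa> * real n" using \<kappa>(1) by real_asymp
  then have "\<forall>\<^sub>F n in sequentially. \<forall>M. \<kappa> * real n \<le> real (card (kr_rows C (nat \<lfloor>\<alpha> * real n\<rfloor>) n M j))"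
  proof eventually_elim
    case (elim n)
    have "2 * \<kappa> * real n \<le> \<alpha> * real n" "2 * \<kappa> * real n \<le> c * real n"
      using \<kappa> by (auto intro: mult_right_mono)
    then have *: "\<kappa> * real n \<le> \<alpha> * real n - 1" "\<kappa> * real n \<le> c * real n - 1"
      using elim by linarith+
    have k: "\<kappa> * real n \<le> real (nat \<lfloor>\<alpha> * real n\<rfloor>)" using * by linarith
    have kk: "\<kappa> * real n \<le> real (kr_k k n (Suc j'))" if "j = Suc j'" for k j'
    proof -
      have "x - 1 \<le> real (2 * nat \<lfloor>x / 2\<rfloor> + 1)" for x :: real by linarith
      from this[of "c * real n"] have "c * real n - 1 \<le> real (kr_k k n (Suc j'))"
        using that by (auto simp: kr_k_def c_def mult.commute split: if_splits)
      then show ?thesis using * by linarith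
    qed
    show ?case
    proof (cases j)
      case 0
      then show ?thesis using k by (simp add: kr_rows_def)
    next
      case (Suc j')
      then show ?thesis using k kk[OF Suc] by (simp add: kr_rows_def card_smallest_indices min_def)
    qed
  qed
  with \<kappa>(1) show ?thesis by blast
qed

section \<open>Stability of the algorithm\<close>

type_synonym 'a model =
  "nat \<Rightarrow> 'a measure \<Rightarrow> ('a \<Rightarrow> (nat \<Rightarrow> nat \<Rightarrow> real) \<times> (nat \<Rightarrow> nat \<Rightarrow> real)) \<Rightarrow> bool"

abbreviation (input) num_rows :: "real \<Rightarrow> nat \<Rightarrow> nat" where
  "num_rows \<alpha> n \<equiv> nat \<lfloor>\<alpha> * real n\<rfloor>"

section \<open>Two coupled runs and their discrepancies\<close>

definition pair_model :: "real \<Rightarrow> 'a model" where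
  "pair_model \<alpha> n \<Omega> Z \<longleftrightarrow>
     gaussian_model (num_rows \<alpha>) (\<lambda>n. n) n \<Omega> (\<lambda>\<omega>. fst (Z \<omega>)) \<and>
     gaussian_model (num_rows \<alpha>) (\<lambda>n. n) n \<Omega> (\<lambda>\<omega>. snd (Z \<omega>))"

definition perturbed :: "nat \<Rightarrow> (nat \<Rightarrow> nat \<Rightarrow> real) \<times> (nat \<Rightarrow> nat \<Rightarrow> real) \<Rightarrow> nat \<Rightarrow> nat \<Rightarrow> real" where
  "perturbed n Z = interpolate (real n powr (- 0.02)) (fst Z) (snd Z)"

definition row_changes :: "real \<Rightarrow> real \<Rightarrow> nat \<Rightarrow> nat \<Rightarrow> (nat \<Rightarrow> nat \<Rightarrow> real) \<times> (nat \<Rightarrow> nat \<Rightarrow> real) \<Rightarrow> nat" where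
  "row_changes C \<alpha> j n Z = card {i. i < num_rows \<alpha> n \<and>
     (i \<in> kr_rows C (num_rows \<alpha> n) n (fst Z) j) \<noteq> (i \<in> kr_rows C (num_rows \<alpha> n) n (perturbed n Z) j)}"

definition sigma_changes :: "real \<Rightarrow> real \<Rightarrow> nat \<Rightarrow> nat \<Rightarrow> (nat \<Rightarrow> nat \<Rightarrow> real) \<times> (nat \<Rightarrow> nat \<Rightarrow> real) \<Rightarrow> nat" where
  "sigma_changes C \<alpha> j n Z = card {t. t < kr_S C n j \<and>
     kr_sigma C (num_rows \<alpha> n) n (fst Z) j t \<noteq> kr_sigma C (num_rows \<alpha> n) n (perturbed n Z) j t}"

text \<open>All \<open>n\<close> columns are counted, not only those of round \<open>j\<close>, so
  that the estimates for the full transposed matrix apply directly.\<close>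

definition sgn_changes :: "real \<Rightarrow> real \<Rightarrow> nat \<Rightarrow> nat \<Rightarrow> (nat \<Rightarrow> nat \<Rightarrow> real) \<times> (nat \<Rightarrow> nat \<Rightarrow> real) \<Rightarrow> nat" where
  "sgn_changes C \<alpha> j n Z = card {t. t < n \<and>
     sgn_pm (\<Sum>i\<in>kr_rows C (num_rows \<alpha> n) n (fst Z) j. fst Z i t) \<noteq>
     sgn_pm (\<Sum>i\<in>kr_rows C (num_rows \<alpha> n) n (perturbed n Z) j. perturbed n Z i t)}"

abbreviation (input) transposed :: "(nat \<Rightarrow> nat \<Rightarrow> real) \<Rightarrow> nat \<Rightarrow> nat \<Rightarrow> real" where
  "transposed X \<equiv> (\<lambda>t i. X i t)"

context
  fixes \<alpha> C :: real
  assumes \<alpha>0: "0 < \<alpha>" and \<alpha>1: "\<alpha> < 0.005" and C0: "0 < C"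
begin

lemma num_rows_le: "num_rows \<alpha> n \<le> n"
proof -
  have "\<alpha> * real n \<le> 1 * real n" using \<alpha>1 by (intro mult_right_mono) auto
  then show ?thesis by linarith
qed

lemma transpose_model:
  assumes "gaussian_model K T n \<Omega> X"
  shows "gaussian_model T K n \<Omega> (\<lambda>\<omega>. transposed (X \<omega>))"
proof -
  have ps: "prob_space \<Omega>" and X: "iid_gaussian_matrix \<Omega> (K n) (T n) X"
    using assms by (simp_all add: gaussian_model_def)
  show ?thesis
    unfolding gaussian_model_def
    by (rule conjI[OF ps prob_space.iid_gaussian_matrix_transpose[OF ps X]])
qed

lemma pair_modelD:
  assumes "pair_model \<alpha> n \<Omega> Z"
  shows "gaussian_model (num_rows \<alpha>) (\<lambda>n. n) n \<Omega> (\<lambda>\<omega>. fst (Z \<omega>))"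
    and "gaussian_model (num_rows \<alpha>) (\<lambda>n. n) n \<Omega> (\<lambda>\<omega>. snd (Z \<omega>))"
    and "gaussian_model (\<lambda>n. n) (num_rows \<alpha>) n \<Omega> (\<lambda>\<omega>. transposed (fst (Z \<omega>)))"
    and "gaussian_model (\<lambda>n. n) (num_rows \<alpha>) n \<Omega> (\<lambda>\<omega>. transposed (snd (Z \<omega>)))"
proof -
  show *: "gaussian_model (num_rows \<alpha>) (\<lambda>n. n) n \<Omega> (\<lambda>\<omega>. fst (Z \<omega>))"
    "gaussian_model (num_rows \<alpha>) (\<lambda>n. n) n \<Omega> (\<lambda>\<omega>. snd (Z \<omega>))"
    using assms by (simp_all add: pair_model_def)
  show "gaussian_model (\<lambda>n. n) (num_rows \<alpha>) n \<Omega> (\<lambda>\<omega>. transposed (fst (Z \<omega>)))"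
    "gaussian_model (\<lambda>n. n) (num_rows \<alpha>) n \<Omega> (\<lambda>\<omega>. transposed (snd (Z \<omega>)))"
    by (rule transpose_model[OF *(1)] transpose_model[OF *(2)])+
qed

text \<open>The matrices are taken in both orientations: rows give the partial inner products,
  columns the sums whose signs are assigned.\<close>

lemma whp_pair_norm_bounded:
  "whp (pair_model \<alpha> :: 'a model) (\<lambda>n Z. (norm_bounded n (num_rows \<alpha> n) n (fst Z) \<and>
      norm_bounded n (num_rows \<alpha> n) n (snd Z)) \<and>
      (norm_bounded n n (num_rows \<alpha> n) (transposed (fst Z)) \<and>
      norm_bounded n n (num_rows \<alpha> n) (transposed (snd Z))))"
proof -
  note nb = whp_norm_bounded[OF num_rows_le order_refl]
  note nbt = whp_norm_bounded[OF order_refl num_rows_le]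
  show ?thesis
    by (rule whp_conj[OF
          whp_conj[OF whp_transform[OF nb, where f = fst] whp_transform[OF nb, where f = snd]]
          whp_conj[OF whp_transform[OF nbt, where f = "\<lambda>Z. transposed (fst Z)"]
            whp_transform[OF nbt, where f = "\<lambda>Z. transposed (snd Z)"]]])
       (erule pair_modelD)+
qed

lemma eventually_powr_small:
  assumes "0 < \<epsilon>"
  shows "\<forall>\<^sub>F n in sequentially. (real n powr (- 0.02))\<^sup>2 \<le> \<epsilon>"
  using assms by real_asymp

text \<open>The column sums are the row sums of the transposed matrix against the 0-1 indicator
  vectors of the selections. Few changes in the selection move them little in square mean, and
  \<open>spread\<close> leaves few of them near 0. The accuracy asked of the selections depends on
  \<open>\<delta>\<close>, which is why the hypothesis covers every
  \<open>\<epsilon>\<close>.\<close>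

lemma whp_sgn_changes:
  assumes rc: "\<And>\<epsilon>. 0 < \<epsilon> \<Longrightarrow> whp (pair_model \<alpha> :: 'a model) (\<lambda>n Z. real (row_changes C \<alpha> j n Z) \<le> \<epsilon> * real n)"
    and \<epsilon>: "0 < \<epsilon>"
  shows "whp (pair_model \<alpha> :: 'a model) (\<lambda>n Z. real (sgn_changes C \<alpha> j n Z) \<le> \<epsilon> * real n)"
proof -
  obtain \<kappa> where \<kappa>: "0 < \<kappa>" and ev\<kappa>: "\<forall>\<^sub>F n in sequentially. \<forall>M. \<kappa> * real n \<le> real (card (kr_rows C (num_rows \<alpha> n) n M j))"
    using kr_rows_card[OF \<alpha>0, of C j] by blast
  have \<epsilon>2: "0 < \<epsilon> / 2" using \<epsilon> by simp
  obtain \<delta> where \<delta>: "0 < \<delta>"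
    and sp: "whp (gaussian_model (\<lambda>n. n) (num_rows \<alpha>) :: nat \<Rightarrow> 'a measure \<Rightarrow> _) (\<lambda>n X. spread \<delta> \<kappa> (\<epsilon> / 2) n n (num_rows \<alpha> n) X)"
    using whp_spread[OF order_refl num_rows_le \<kappa> \<epsilon>2] by blast
  \<comment> \<open>The squared movement is at most \<open>384 * \<epsilon>' * n\<^sup>2\<close>;
    divided by \<open>w\<^sup>2 = \<delta>\<^sup>2 * n\<close> it costs
    \<open>384 / 800 * \<epsilon> * n\<close>, less than half of the budget.\<close>
  define \<epsilon>' where "\<epsilon>' = \<epsilon> * \<delta>\<^sup>2 / 800"
  have \<epsilon>': "0 < \<epsilon>'" using \<epsilon> \<delta> by (simp add: \<epsilon>'_def)
  have sp': "whp (pair_model \<alpha> :: 'a model) (\<lambda>n Z. spread \<delta> \<kappa> (\<epsilon> / 2) n n (num_rows \<alpha> n) (transposed (fst Z)))"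
    by (rule whp_transform[OF sp]) (rule pair_modelD)
  show ?thesis
  proof (rule whp_mono[OF whp_conj[OF whp_conj[OF whp_pair_norm_bounded sp'] rc[OF \<epsilon>']]])
    show "\<forall>\<^sub>F n in sequentially. \<forall>Z.
      (((norm_bounded n (num_rows \<alpha> n) n (fst Z) \<and> norm_bounded n (num_rows \<alpha> n) n (snd Z)) \<and>
       (norm_bounded n n (num_rows \<alpha> n) (transposed (fst Z)) \<and> norm_bounded n n (num_rows \<alpha> n) (transposed (snd Z)))) \<and>
       spread \<delta> \<kappa> (\<epsilon> / 2) n n (num_rows \<alpha> n) (transposed (fst Z))) \<and>
       real (row_changes C \<alpha> j n Z) \<le> \<epsilon>' * real n \<longrightarrow>
      real (sgn_changes C \<alpha> j n Z) \<le> \<epsilon> * real n"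
      using ev\<kappa> eventually_powr_small[OF \<epsilon>'] eventually_gt_at_top[of 0]
    proof eventually_elim
      case (elim n)
      show ?case
      proof (intro allI impI, elim conjE)
        fix Z :: "(nat \<Rightarrow> nat \<Rightarrow> real) \<times> (nat \<Rightarrow> nat \<Rightarrow> real)"
        assume nb: "norm_bounded n n (num_rows \<alpha> n) (transposed (fst Z))" "norm_bounded n n (num_rows \<alpha> n) (transposed (snd Z))"
          and sp: "spread \<delta> \<kappa> (\<epsilon> / 2) n n (num_rows \<alpha> n) (transposed (fst Z))"
          and rc: "real (row_changes C \<alpha> j n Z) \<le> \<epsilon>' * real n"
        define k where "k = num_rows \<alpha> n"
        define \<tau> where "\<tau> = real n powr (- 0.02)"
        define I where "I = kr_rows C k n (fst Z) j"
        define I' where "I' = kr_rows C k n (perturbed n Z) j"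
        define x where "x i = (if i \<in> I then 1 else 0 :: real)" for i
        define y where "y i = (if i \<in> I' then 1 else 0 :: real)" for i
        define w where "w = \<delta> * sqrt (real n)"
        have w: "0 < w" using \<delta> elim by (simp add: w_def)
        have "I \<subseteq> {..<k}" "I' \<subseteq> {..<k}" by (simp_all add: I_def I'_def kr_rows_subset)
        then have sub: "{..<k} \<inter> I = I" "{..<k} \<inter> I' = I'" by auto
        have sx: "(\<Sum>i<k. x i * X i t) = (\<Sum>i\<in>I. X i t)" for X :: "nat \<Rightarrow> nat \<Rightarrow> real" and t
          using sum.inter_restrict[of "{..<k}" "\<lambda>i. X i t" I] by (simp add: sub x_def if_distrib if_distribR cong: if_cong)
        have sy: "(\<Sum>i<k. y i * X i t) = (\<Sum>i\<in>I'. X i t)" for X :: "nat \<Rightarrow> nat \<Rightarrow> real" and t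
          using sum.inter_restrict[of "{..<k}" "\<lambda>i. X i t" I'] by (simp add: sub y_def if_distrib if_distribR cong: if_cong)
        have x2: "(\<Sum>i<k. (x i)\<^sup>2) = real (card I)"
          using sum.inter_restrict[of "{..<k}" "\<lambda>i. 1 :: real" I] by (simp add: sub x_def if_distrib if_distribR cong: if_cong)
        have "{i. i < k \<and> x i \<noteq> y i} = {i. i < k \<and> (i \<in> I) \<noteq> (i \<in> I')}"
          by (auto simp: x_def y_def)
        then have d: "real (card {i. i < k \<and> x i \<noteq> y i}) \<le> \<epsilon>' * real n"
          using rc by (simp add: row_changes_def I_def I'_def k_def)
        have pert: "interpolate \<tau> (transposed (fst Z)) (transposed (snd Z)) t i = perturbed n Z i t" for i t
          by (simp add: interpolate_def perturbed_def \<tau>_def)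
        have "(\<Sum>t<n. ((\<Sum>i<k. x i * fst Z i t) - (\<Sum>i<k. y i * interpolate \<tau> (transposed (fst Z)) (transposed (snd Z)) t i))\<^sup>2)
            \<le> 192 * real n * (real (card {i. i < k \<and> x i \<noteq> y i}) + \<tau>\<^sup>2 * real n)"
          by (rule norm_bounded_interpolate) (use nb num_rows_le in \<open>auto simp: k_def x_def y_def\<close>)
        also have "\<dots> \<le> 192 * real n * (\<epsilon>' * real n + \<epsilon>' * real n)"
          using d elim(2) by (intro mult_left_mono add_mono mult_right_mono) (auto simp: \<tau>_def)
        finally have R: "(\<Sum>t<n. ((\<Sum>i\<in>I. fst Z i t) - (\<Sum>i\<in>I'. perturbed n Z i t))\<^sup>2) \<le> 384 * \<epsilon>' * (real n)\<^sup>2"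
          unfolding pert sx sy by (simp add: power2_eq_square algebra_simps)
        have b: "real (card {t. t < n \<and> \<bar>\<Sum>i\<in>I. fst Z i t\<bar> \<le> w}) \<le> \<epsilon> / 2 * real n"
        proof -
          have "x \<in> {..<k} \<rightarrow> small_ints" by (auto simp: x_def)
          moreover have "\<kappa> * real n \<le> (\<Sum>i<k. (x i)\<^sup>2)" using elim(1) unfolding x2 by (simp add: I_def k_def)
          ultimately have "real (card {t. t < n \<and> \<bar>(\<Sum>i<k. x i * fst Z i t) - 0\<bar> \<le> \<delta> * sqrt n}) \<le> \<epsilon> / 2 * real n"
            using sp unfolding spread_def k_def by blast
          then show ?thesis by (simp add: sx w_def)
        qed
        have "real (sgn_changes C \<alpha> j n Z) \<le> 384 * \<epsilon>' * (real n)\<^sup>2 / w\<^sup>2 + \<epsilon> / 2 * real n"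
          using sgn_pm_stable[OF R w b] by (simp add: sgn_changes_def I_def I'_def k_def)
        also have "384 * \<epsilon>' * (real n)\<^sup>2 / w\<^sup>2 = 384 / 800 * \<epsilon> * real n"
          using \<delta> elim(3) by (simp add: w_def \<epsilon>'_def power_mult_distrib power2_eq_square)
        also have "384 / 800 * \<epsilon> * real n + \<epsilon> / 2 * real n \<le> \<epsilon> * real n"
          using \<epsilon> by (simp add: algebra_simps)
        finally show "real (sgn_changes C \<alpha> j n Z) \<le> \<epsilon> * real n" .
      qed
    qed
  qed
qed

text \<open>The partial inner products are row sums against the partial assignments. Few changed
  coordinates and a small \<open>\<tau>\<close> move them little in square mean, and
  \<open>spread\<close> leaves few near the selection threshold.\<close>

lemma whp_row_changes_Suc:
  assumes sc: "\<And>\<epsilon>. 0 < \<epsilon> \<Longrightarrow> whp (pair_model \<alpha> :: 'a model) (\<lambda>n Z. real (sigma_changes C \<alpha> j n Z) \<le> \<epsilon> * real n)"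
    and \<epsilon>: "0 < \<epsilon>"
  shows "whp (pair_model \<alpha> :: 'a model) (\<lambda>n Z. real (row_changes C \<alpha> (Suc j) n Z) \<le> \<epsilon> * real n)"
proof -
  have \<epsilon>4: "0 < \<epsilon> / 4" using \<epsilon> by simp
  \<comment> \<open>The value 1/4 is admissible since
    \<open>kr_S C n j \<ge> n / 2 - 1 \<ge> n / 4\<close> for \<open>n > 4\<close>.\<close>
  have \<kappa>: "0 < (1 / 4 :: real)" by simp
  obtain \<delta> where \<delta>: "0 < \<delta>"
    and sp: "whp (gaussian_model (num_rows \<alpha>) (\<lambda>n. n) :: nat \<Rightarrow> 'a measure \<Rightarrow> _) (\<lambda>n X. spread \<delta> (1 / 4) (\<epsilon> / 4) n (num_rows \<alpha> n) n X)"
    using whp_spread[OF num_rows_le order_refl \<kappa> \<epsilon>4] by blast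
  \<comment> \<open>Yields \<open>2 * (4 * 384 / 8000 + 1 / 4) < 1\<close> in the final
    estimate.\<close>
  define \<epsilon>' where "\<epsilon>' = \<epsilon> * \<delta>\<^sup>2 / 8000"
  have \<epsilon>': "0 < \<epsilon>'" using \<epsilon> \<delta> by (simp add: \<epsilon>'_def)
  have sp': "whp (pair_model \<alpha> :: 'a model) (\<lambda>n Z. spread \<delta> (1 / 4) (\<epsilon> / 4) n (num_rows \<alpha> n) n (fst Z))"
    by (rule whp_transform[OF sp]) (rule pair_modelD)
  show ?thesis
  proof (rule whp_mono[OF whp_conj[OF whp_conj[OF whp_pair_norm_bounded sp'] sc[OF \<epsilon>']]])
    show "\<forall>\<^sub>F n in sequentially. \<forall>Z.
      (((norm_bounded n (num_rows \<alpha> n) n (fst Z) \<and> norm_bounded n (num_rows \<alpha> n) n (snd Z)) \<and>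
       (norm_bounded n n (num_rows \<alpha> n) (transposed (fst Z)) \<and> norm_bounded n n (num_rows \<alpha> n) (transposed (snd Z)))) \<and>
       spread \<delta> (1 / 4) (\<epsilon> / 4) n (num_rows \<alpha> n) n (fst Z)) \<and>
       real (sigma_changes C \<alpha> j n Z) \<le> \<epsilon>' * real n \<longrightarrow>
      real (row_changes C \<alpha> (Suc j) n Z) \<le> \<epsilon> * real n"
      using kr_N_tendsto[OF C0, of j] eventually_powr_small[OF \<epsilon>'] eventually_gt_at_top[of 4]
    proof eventually_elim
      case (elim n)
      show ?case
      proof (intro allI impI, elim conjE)
        fix Z :: "(nat \<Rightarrow> nat \<Rightarrow> real) \<times> (nat \<Rightarrow> nat \<Rightarrow> real)"
        assume nb: "norm_bounded n (num_rows \<alpha> n) n (fst Z)" "norm_bounded n (num_rows \<alpha> n) n (snd Z)"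
          and sp: "spread \<delta> (1 / 4) (\<epsilon> / 4) n (num_rows \<alpha> n) n (fst Z)"
          and sc: "real (sigma_changes C \<alpha> j n Z) \<le> \<epsilon>' * real n"
        define k where "k = num_rows \<alpha> n"
        define \<tau> where "\<tau> = real n powr (- 0.02)"
        define S where "S = kr_S C n j"
        define \<sigma> where "\<sigma> = kr_sigma C k n (fst Z) j"
        define \<sigma>' where "\<sigma>' = kr_sigma C k n (perturbed n Z) j"
        \<comment> \<open>Zeros replace the \<open>undefined\<close> values beyond \<open>S\<close>,
          so that the vectors have length \<open>n\<close> and entries in
          \<open>{-1, 0, 1}\<close>.\<close>
        define x where "x t = (if t < S then \<sigma> t else 0 :: real)" for t
        define y where "y t = (if t < S then \<sigma>' t else 0 :: real)" for t
        define w where "w = \<delta> * sqrt (real n)"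
        have w: "0 < w" using \<delta> elim by (simp add: w_def)
        have Sn: "S \<le> n" unfolding S_def using elim(1) by (rule kr_S_le)
        have S4: "real n / 4 \<le> real S" using kr_S_ge[of n C j] elim(3) by (simp add: S_def)
        have \<sigma>: "\<sigma> t \<in> {-1, 1}" "\<sigma>' t \<in> {-1, 1}" if "t < S" for t
          using kr_sigma_range[of C k n "fst Z" j] kr_sigma_range[of C k n "perturbed n Z" j] that
          unfolding \<sigma>_def \<sigma>'_def S_def by (auto simp: PiE_iff)
        have SI: "{..<n} \<inter> {..<S} = {..<S}" using Sn by auto
        have sx: "(\<Sum>t<n. x t * X i t) = (\<Sum>t<S. X i t * \<sigma> t)" for X :: "nat \<Rightarrow> nat \<Rightarrow> real" and i
          using sum.inter_restrict[of "{..<n}" "\<lambda>t. X i t * \<sigma> t" "{..<S}"]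
          by (simp add: SI x_def if_distrib if_distribR mult.commute cong: if_cong)
        have sy: "(\<Sum>t<n. y t * X i t) = (\<Sum>t<S. X i t * \<sigma>' t)" for X :: "nat \<Rightarrow> nat \<Rightarrow> real" and i
          using sum.inter_restrict[of "{..<n}" "\<lambda>t. X i t * \<sigma>' t" "{..<S}"]
          by (simp add: SI y_def if_distrib if_distribR mult.commute cong: if_cong)
        have x2: "(\<Sum>t<n. (x t)\<^sup>2) = real S"
        proof -
          have "(\<Sum>t<n. (x t)\<^sup>2) = (\<Sum>t<S. 1)"
            using Sn \<sigma> by (intro sum.mono_neutral_cong_right) (auto simp: x_def dest!: \<sigma>(1))
          then show ?thesis by simp
        qed
        have "{t. t < n \<and> x t \<noteq> y t} = {t. t < S \<and> \<sigma> t \<noteq> \<sigma>' t}"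
          using Sn by (auto simp: x_def y_def)
        then have d: "real (card {t. t < n \<and> x t \<noteq> y t}) \<le> \<epsilon>' * real n"
          using sc by (simp add: sigma_changes_def S_def \<sigma>_def \<sigma>'_def k_def)
        have pert: "interpolate \<tau> (fst Z) (snd Z) = perturbed n Z"
          by (simp add: perturbed_def \<tau>_def)
        have "x t \<in> {-1, 0, 1}" "y t \<in> {-1, 0, 1}" for t
          using \<sigma>[of t] by (cases "t < S"; auto simp: x_def y_def)+
        then have xr: "x \<in> {..<n} \<rightarrow> {-1, 0, 1}" and yr: "y \<in> {..<n} \<rightarrow> {-1, 0, 1}" by blast+
        have "(\<Sum>i<k. ((\<Sum>t<n. x t * fst Z i t) - (\<Sum>t<n. y t * interpolate \<tau> (fst Z) (snd Z) i t))\<^sup>2)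
            \<le> 192 * real n * (real (card {t. t < n \<and> x t \<noteq> y t}) + \<tau>\<^sup>2 * real n)"
          by (rule norm_bounded_interpolate) (use nb xr yr in \<open>auto simp: k_def\<close>)
        also have "\<dots> \<le> 192 * real n * (\<epsilon>' * real n + \<epsilon>' * real n)"
          using d elim(2) by (intro mult_left_mono add_mono mult_right_mono) (auto simp: \<tau>_def)
        finally have R: "(\<Sum>i<k. ((\<Sum>t<S. fst Z i t * \<sigma> t) - (\<Sum>t<S. perturbed n Z i t * \<sigma>' t))\<^sup>2) \<le> 384 * \<epsilon>' * (real n)\<^sup>2"
          unfolding pert sx sy by (simp add: power2_eq_square algebra_simps)
        have b: "real (card {i. i < k \<and> \<bar>(\<Sum>t<S. fst Z i t * \<sigma> t) - c\<bar> \<le> w}) \<le> \<epsilon> / 4 * real n" for c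
        proof -
          have "x \<in> {..<n} \<rightarrow> small_ints" using xr by auto
          moreover have "1 / 4 * real n \<le> (\<Sum>t<n. (x t)\<^sup>2)" using S4 by (simp add: x2)
          ultimately have "real (card {i. i < k \<and> \<bar>(\<Sum>t<n. x t * fst Z i t) - c\<bar> \<le> \<delta> * sqrt n}) \<le> \<epsilon> / 4 * real n"
            using sp unfolding spread_def k_def by blast
          then show ?thesis by (simp add: sx w_def)
        qed
        have "real (row_changes C \<alpha> (Suc j) n Z) \<le> 2 * (4 * (384 * \<epsilon>' * (real n)\<^sup>2) / w\<^sup>2 + \<epsilon> / 4 * real n)"
          using smallest_indices_stable[OF R w b]
          by (simp add: row_changes_def kr_rows_def S_def \<sigma>_def \<sigma>'_def k_def)
        also have "4 * (384 * \<epsilon>' * (real n)\<^sup>2) / w\<^sup>2 = 4 * 384 / 8000 * \<epsilon> * real n"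
          using \<delta> elim(3) by (simp add: w_def \<epsilon>'_def power_mult_distrib power2_eq_square)
        also have "2 * (4 * 384 / 8000 * \<epsilon> * real n + \<epsilon> / 4 * real n) \<le> \<epsilon> * real n"
          using \<epsilon> by (simp add: algebra_simps)
        finally show "real (row_changes C \<alpha> (Suc j) n Z) \<le> \<epsilon> * real n" .
      qed
    qed
  qed
qed

text \<open>Induction on the round, alternating between the kinds of change: assignments determine
  the partial inner products, these the next selection, and this the next signs. The accuracy
  \<open>\<epsilon>\<close> is generalised because each passage asks for a finer one before
  it.\<close>

lemma whp_sigma_changes:
  assumes "0 < \<epsilon>"
  shows "whp (pair_model \<alpha> :: 'a model) (\<lambda>n Z. real (sigma_changes C \<alpha> j n Z) \<le> \<epsilon> * real n)"
  using assms
proof (induction j arbitrary: \<epsilon>)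
  case 0
  \<comment> \<open>Round 0 selects all rows in both runs.\<close>
  have "whp (pair_model \<alpha> :: 'a model) (\<lambda>n Z. real (row_changes C \<alpha> 0 n Z) \<le> \<epsilon> * real n)" if "0 < \<epsilon>" for \<epsilon>
    by (rule whp_eventually) (use that in \<open>simp add: row_changes_def kr_rows_def\<close>)
  then have sg: "whp (pair_model \<alpha> :: 'a model) (\<lambda>n Z. real (sgn_changes C \<alpha> 0 n Z) \<le> \<epsilon> * real n)"
    using 0 by (intro whp_sgn_changes)
  show ?case
  proof (rule whp_mono[OF sg], intro always_eventually allI impI)
    fix n Z assume *: "real (sgn_changes C \<alpha> 0 n Z) \<le> \<epsilon> * real n"
    have "sigma_changes C \<alpha> 0 n Z \<le> sgn_changes C \<alpha> 0 n Z"
      unfolding sigma_changes_def sgn_changes_def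
    proof (intro card_mono subsetI)
      fix t assume t: "t \<in> {t. t < kr_S C n 0 \<and>
        kr_sigma C (num_rows \<alpha> n) n (fst Z) 0 t \<noteq> kr_sigma C (num_rows \<alpha> n) n (perturbed n Z) 0 t}"
      moreover have "kr_S C n 0 \<le> n" by (rule kr_S_le) simp
      ultimately show "t \<in> {t. t < n \<and>
        sgn_pm (\<Sum>i\<in>kr_rows C (num_rows \<alpha> n) n (fst Z) 0. fst Z i t) \<noteq>
        sgn_pm (\<Sum>i\<in>kr_rows C (num_rows \<alpha> n) n (perturbed n Z) 0. perturbed n Z i t)}"
        by (auto simp: kr_sigma_0 simp del: kr_sigma.simps)
    qed auto
    with * show "real (sigma_changes C \<alpha> 0 n Z) \<le> \<epsilon> * real n" by linarith
  qed
next
  case (Suc j)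
  have \<epsilon>2: "0 < \<epsilon> / 2" using Suc.prems by simp
  have sg: "whp (pair_model \<alpha> :: 'a model) (\<lambda>n Z. real (sgn_changes C \<alpha> (Suc j) n Z) \<le> \<epsilon> / 2 * real n)"
    by (rule whp_sgn_changes[OF whp_row_changes_Suc[OF Suc.IH] \<epsilon>2])
  show ?case
  proof (rule whp_mono[OF whp_conj[OF Suc.IH[OF \<epsilon>2] sg]])
    show "\<forall>\<^sub>F n in sequentially. \<forall>Z. real (sigma_changes C \<alpha> j n Z) \<le> \<epsilon> / 2 * real n \<and>
        real (sgn_changes C \<alpha> (Suc j) n Z) \<le> \<epsilon> / 2 * real n \<longrightarrow>
        real (sigma_changes C \<alpha> (Suc j) n Z) \<le> \<epsilon> * real n"
      using kr_N_tendsto[OF C0, of "Suc j"]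
    proof eventually_elim
      case (elim n)
      show ?case
      proof (intro allI impI, elim conjE)
        fix Z :: "(nat \<Rightarrow> nat \<Rightarrow> real) \<times> (nat \<Rightarrow> nat \<Rightarrow> real)"
        assume *: "real (sigma_changes C \<alpha> j n Z) \<le> \<epsilon> / 2 * real n"
          "real (sgn_changes C \<alpha> (Suc j) n Z) \<le> \<epsilon> / 2 * real n"
        have le: "kr_S C n (Suc j) \<le> n" using elim by (rule kr_S_le)
        let ?A = "{t. t < kr_S C n j \<and>
          kr_sigma C (num_rows \<alpha> n) n (fst Z) j t \<noteq> kr_sigma C (num_rows \<alpha> n) n (perturbed n Z) j t}"
        let ?B = "{t. t < n \<and>
          sgn_pm (\<Sum>i\<in>kr_rows C (num_rows \<alpha> n) n (fst Z) (Suc j). fst Z i t) \<noteq>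
          sgn_pm (\<Sum>i\<in>kr_rows C (num_rows \<alpha> n) n (perturbed n Z) (Suc j). perturbed n Z i t)}"
        have "sigma_changes C \<alpha> (Suc j) n Z \<le> card (?A \<union> ?B)"
          unfolding sigma_changes_def
          by (intro card_mono) (use le in \<open>auto simp: kr_sigma_Suc simp del: kr_sigma.simps split: if_splits\<close>)
        also have "\<dots> \<le> sigma_changes C \<alpha> j n Z + sgn_changes C \<alpha> (Suc j) n Z"
          unfolding sigma_changes_def sgn_changes_def by (rule card_Un_le)
        finally show "real (sigma_changes C \<alpha> (Suc j) n Z) \<le> \<epsilon> * real n" using * by simp
      qed
    qed
  qed
qed

text \<open>Half of the budget is spent on the rounds up to \<open>J\<close>; all coordinates
  assigned later are counted as changed, and they fit into the other half.\<close>

lemma whp_hamming_dist: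
  assumes \<epsilon>: "0 < \<epsilon>"
  shows "whp (pair_model \<alpha> :: 'a model) (\<lambda>n Z. real (hamming_dist n (kim_roche C (num_rows \<alpha> n) n (fst Z))
    (kim_roche C (num_rows \<alpha> n) n (perturbed n Z))) \<le> \<epsilon> * real n)"
proof -
  have \<epsilon>2: "0 < \<epsilon> / 2" using \<epsilon> by simp
  obtain J where J: "1 / 2 ^ J < \<epsilon> / 4"
    using real_arch_pow_inv[of "\<epsilon> / 4" "1 / 2"] \<epsilon> by (auto simp: power_one_over)
  \<comment> \<open>Absorbs the rounding term 1 of \<open>kr_S_tail\<close>.\<close>
  have ev: "\<forall>\<^sub>F n in sequentially. 1 \<le> \<epsilon> / 4 * real n" using \<epsilon> by real_asymp
  show ?thesis
  proof (rule whp_mono[OF whp_sigma_changes[OF \<epsilon>2, of J]])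
    show "\<forall>\<^sub>F n in sequentially. \<forall>Z. real (sigma_changes C \<alpha> J n Z) \<le> \<epsilon> / 2 * real n \<longrightarrow>
      real (hamming_dist n (kim_roche C (num_rows \<alpha> n) n (fst Z))
        (kim_roche C (num_rows \<alpha> n) n (perturbed n Z))) \<le> \<epsilon> * real n"
      using kr_N_tendsto[OF C0, of J] ev
    proof eventually_elim
      case (elim n)
      show ?case
      proof (intro allI impI)
        fix Z :: "(nat \<Rightarrow> nat \<Rightarrow> real) \<times> (nat \<Rightarrow> nat \<Rightarrow> real)"
        assume *: "real (sigma_changes C \<alpha> J n Z) \<le> \<epsilon> / 2 * real n"
        let ?A = "{t. t < kr_S C n J \<and>
          kr_sigma C (num_rows \<alpha> n) n (fst Z) J t \<noteq> kr_sigma C (num_rows \<alpha> n) n (perturbed n Z) J t}"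
        have "hamming_dist n (kim_roche C (num_rows \<alpha> n) n (fst Z)) (kim_roche C (num_rows \<alpha> n) n (perturbed n Z))
          \<le> card (?A \<union> {kr_S C n J..<n})"
          unfolding hamming_dist_def kim_roche_def
          by (intro card_mono) (auto simp: kr_sigma_stable[OF elim(1)] not_less)
        also have "\<dots> \<le> sigma_changes C \<alpha> J n Z + card {kr_S C n J..<n}"
          unfolding sigma_changes_def by (rule card_Un_le)
        finally have "real (hamming_dist n (kim_roche C (num_rows \<alpha> n) n (fst Z)) (kim_roche C (num_rows \<alpha> n) n (perturbed n Z)))
          \<le> \<epsilon> / 2 * real n + (real n - real (kr_S C n J))"
          using * kr_S_le[OF elim(1)] by simp
        also have "real n - real (kr_S C n J) \<le> real n / 2 ^ J + 1" by (rule kr_S_tail[OF elim(1)])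
        also have "real n / 2 ^ J \<le> \<epsilon> / 4 * real n"
          using mult_right_mono[OF less_imp_le[OF J], of "real n"] by simp
        finally show "real (hamming_dist n (kim_roche C (num_rows \<alpha> n) n (fst Z))
          (kim_roche C (num_rows \<alpha> n) n (perturbed n Z))) \<le> \<epsilon> * real n"
          using elim(2) by simp
      qed
    qed
  qed
qed

end

section \<open>Measurability of the output\<close>

lemma pred_smallest_indices:
  assumes [measurable]: "\<And>i. i < k \<Longrightarrow> (\<lambda>\<omega>. p \<omega> i) \<in> borel_measurable \<Omega>"
  shows "Measurable.pred \<Omega> (\<lambda>\<omega>. i \<in> smallest_indices k m (p \<omega>))"
proof (cases "i < k")
  case True
  \<comment> \<open>The rank is written as a finite sum of indicators, whose measurability is that
    of comparisons between scores.\<close>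
  have eq: "i \<in> smallest_indices k m q \<longleftrightarrow>
      (\<Sum>i'<k. if q i' < q i \<or> q i' = q i \<and> i' < i then 1 else 0 :: real) < real m" for q :: "nat \<Rightarrow> real"
  proof -
    have "(\<Sum>i'<k. if q i' < q i \<or> q i' = q i \<and> i' < i then 1 else 0 :: real)
        = (\<Sum>i' | i' < k \<and> (q i' < q i \<or> q i' = q i \<and> i' < i). 1)"
      by (rule sum.mono_neutral_cong_right) auto
    then show ?thesis using True by (simp add: smallest_indices_def)
  qed
  show ?thesis unfolding eq using True by measurable
qed (simp add: smallest_indices_def)

lemma kr_sigma_measurable:
  assumes X: "\<And>i t. i < k \<Longrightarrow> t < n \<Longrightarrow> (\<lambda>\<omega>. X \<omega> i t) \<in> borel_measurable \<Omega>"
    and j: "j \<le> kr_N C n"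
  shows "(\<lambda>\<omega>. kr_sigma C k n (X \<omega>) j t) \<in> borel_measurable \<Omega>"
  using j
proof (induction j arbitrary: t)
  case 0
  have sgn[measurable]: "sgn_pm \<in> borel_measurable borel" unfolding sgn_pm_def[abs_def] by measurable
  have "kr_S C n 0 \<le> n" by (rule kr_S_le) simp
  then show ?case
    by (cases "t < kr_S C n 0") (auto intro!: measurable_compose[OF _ sgn] borel_measurable_sum X)
next
  case (Suc j)
  have sgn[measurable]: "sgn_pm \<in> borel_measurable borel" unfolding sgn_pm_def[abs_def] by measurable
  have le: "kr_S C n j \<le> n" "kr_S C n (Suc j) \<le> n" using Suc.prems by (auto intro!: kr_S_le)
  have IH[measurable]: "(\<lambda>\<omega>. kr_sigma C k n (X \<omega>) j t) \<in> borel_measurable \<Omega>" for t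
    using Suc by auto
  define p where "p \<omega> i = (\<Sum>t<kr_S C n j. X \<omega> i t * kr_sigma C k n (X \<omega>) j t)" for \<omega> i
  have p: "(\<lambda>\<omega>. p \<omega> i) \<in> borel_measurable \<Omega>" if "i < k" for i
    unfolding p_def using that le by (intro borel_measurable_sum borel_measurable_times X IH) auto
  define I where "I \<omega> = smallest_indices k (kr_k k n (Suc j)) (p \<omega>)" for \<omega>
  have I[measurable]: "Measurable.pred \<Omega> (\<lambda>\<omega>. i \<in> I \<omega>)" for i
    unfolding I_def by (rule pred_smallest_indices) (rule p)
  \<comment> \<open>A sum over a random index set becomes a sum over a fixed range, so that
    measurability can be checked term by term.\<close>
  have sum_I: "(\<Sum>i\<in>I \<omega>. X \<omega> i t) = (\<Sum>i<k. if i \<in> I \<omega> then X \<omega> i t else 0)" for \<omega> t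
  proof -
    have "{..<k} \<inter> I \<omega> = I \<omega>" by (auto simp: I_def smallest_indices_def)
    then show ?thesis using sum.inter_restrict[of "{..<k}" "\<lambda>i. X \<omega> i t" "I \<omega>"] by simp
  qed
  have "(\<lambda>\<omega>. sgn_pm (\<Sum>i\<in>I \<omega>. X \<omega> i t)) \<in> borel_measurable \<Omega>" if "t < kr_S C n (Suc j)" for t
    unfolding sum_I using that le
    by (intro measurable_compose[OF _ sgn] borel_measurable_sum measurable_If I X) auto
  moreover have "kr_sigma C k n (X \<omega>) (Suc j) t =
      (if kr_S C n j \<le> t \<and> t < kr_S C n (Suc j) then sgn_pm (\<Sum>i\<in>I \<omega>. X \<omega> i t)
       else kr_sigma C k n (X \<omega>) j t)" for \<omega>
    by (simp add: Let_def I_def p_def[abs_def])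
  ultimately show ?case
    using IH by (cases "kr_S C n j \<le> t \<and> t < kr_S C n (Suc j)") (simp_all del: kr_sigma.simps)
qed

section \<open>A single sublinear bound from all fixed accuracies\<close>

theorem theorem3p8:
  fixes \<alpha> C :: real
  assumes "0 < \<alpha>" and "\<alpha> < 0.005" and "0 < C"
  shows "\<exists>(g :: nat \<Rightarrow> real) (h :: nat \<Rightarrow> real).
    g \<in> o(\<lambda>n. real n) \<and> h \<in> O(\<lambda>n. real n powr (- 1 / 41)) \<and>
    (\<forall>(n :: nat) (k :: nat) (\<tau> :: real) (\<Omega> :: 'a measure) M M'.
       k = nat \<lfloor>\<alpha> * real n\<rfloor> \<longrightarrow> \<tau> = real n powr (- 0.02) \<longrightarrow>
       prob_space \<Omega> \<longrightarrow>
       iid_gaussian_matrix \<Omega> k n M \<longrightarrow> iid_gaussian_matrix \<Omega> k n M' \<longrightarrow>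
       indep_matrices \<Omega> k n M M' \<longrightarrow>
       \<P>(\<omega> in \<Omega>. real (hamming_dist n (kim_roche C k n (M \<omega>))
                                      (kim_roche C k n (interpolate \<tau> (M \<omega>) (M' \<omega>)))) \<le> g n)
         \<ge> 1 - h n)"
proof -
  define ham where "ham n Z = real (hamming_dist n (kim_roche C (num_rows \<alpha> n) n (fst Z))
    (kim_roche C (num_rows \<alpha> n) n (perturbed n Z)))" for n Z
  have ham_le: "ham n Z \<le> real n" for n Z
  proof -
    have "hamming_dist n x y \<le> card {..<n}" for x y
      unfolding hamming_dist_def by (intro card_mono) auto
    then show ?thesis by (simp add: ham_def)
  qed
  define P where "P m n \<longleftrightarrow> (\<forall>(\<Omega> :: 'a measure) Z. pair_model \<alpha> n \<Omega> Z \<longrightarrow>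
     (\<exists>E\<in>sets \<Omega>. measure \<Omega> E \<le> real n powr (- 1 / 41) \<and>
       (\<forall>\<omega>\<in>space \<Omega> - E. ham n (Z \<omega>) \<le> 1 / real (Suc m) * real n)))" for m n
  have "\<forall>\<^sub>F n in sequentially. P m n" for m
  proof -
    have "whp (pair_model \<alpha> :: 'a model) (\<lambda>n Z. ham n Z \<le> 1 / real (Suc m) * real n)"
      unfolding ham_def by (rule whp_hamming_dist[OF assms]) simp
    then obtain A where A: "\<forall>\<^sub>F n in sequentially. \<forall>(\<Omega> :: 'a measure) Z. pair_model \<alpha> n \<Omega> Z \<longrightarrow>
      (\<exists>E\<in>sets \<Omega>. measure \<Omega> E \<le> A / 2 ^ n \<and> (\<forall>\<omega>\<in>space \<Omega> - E. ham n (Z \<omega>) \<le> 1 / real (Suc m) * real n))"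
      unfolding whp_def ..
    \<comment> \<open>For each fixed \<open>m\<close> the exponentially small failure probability is
      eventually below the target rate.\<close>
    have "\<forall>\<^sub>F n in sequentially. A / 2 ^ n \<le> real n powr (- 1 / 41)" by real_asymp
    with A show ?thesis unfolding P_def
      by eventually_elim (meson order_trans)
  qed
  then obtain N where N: "\<And>m n. N m \<le> n \<Longrightarrow> P m n"
    unfolding eventually_sequentially by metis
  \<comment> \<open>Diagonalisation: \<open>g\<close> uses the best accuracy \<open>1 / (m + 1)\<close> that is already available at \<open>n\<close>.\<close>
  define D where "D n = {m. m \<le> n \<and> N m \<le> n}" for n
  \<comment> \<open>The clause \<open>m \<le> n\<close> bounds the set, so that \<open>Max\<close>
    is meaningful even if \<open>N\<close> is bounded.\<close>
  have finD: "finite (D n)" for n by (auto simp: D_def)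
  \<comment> \<open>While no accuracy is available, \<open>n\<close> is a trivial bound on the
    Hamming distance, so the probability estimate holds for every \<open>n\<close>.\<close>
  define g where "g n = (if D n = {} then real n else 1 / real (Suc (Max (D n))) * real n)" for n
  have g: "g \<in> o(\<lambda>n. real n)"
  proof (rule landau_o.smallI)
    fix c :: real assume "0 < c"
    then obtain m where m: "1 / real (Suc m) < c" using nat_approx_posE by metis
    have "\<forall>\<^sub>F n in sequentially. max m (N m) \<le> n" by (rule eventually_ge_at_top)
    then show "\<forall>\<^sub>F n in sequentially. norm (g n) \<le> c * norm (real n)"
    proof eventually_elim
      case (elim n)
      then have mD: "m \<in> D n" by (simp add: D_def)
      then have "m \<le> Max (D n)" using finD by simp
      then have "1 / real (Suc (Max (D n))) \<le> 1 / real (Suc m)" by (intro divide_left_mono) auto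
      then have "1 / real (Suc (Max (D n))) * real n \<le> c * real n"
        using m by (intro mult_right_mono) auto
      moreover have "g n = 1 / real (Suc (Max (D n))) * real n" using mD by (auto simp: g_def)
      ultimately show ?case by simp
    qed
  qed
  have "1 - real n powr (- 1 / 41) \<le> \<P>(\<omega> in \<Omega>. real (hamming_dist n (kim_roche C (num_rows \<alpha> n) n (M \<omega>))
      (kim_roche C (num_rows \<alpha> n) n (interpolate (real n powr (- 0.02)) (M \<omega>) (M' \<omega>)))) \<le> g n)"
    if \<Omega>: "prob_space \<Omega>" and M: "iid_gaussian_matrix \<Omega> (num_rows \<alpha> n) n M"
      and M': "iid_gaussian_matrix \<Omega> (num_rows \<alpha> n) n M'" for n and \<Omega> :: "'a measure" and M M'
  proof -
    interpret prob_space \<Omega> by fact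
    define Z where "Z \<omega> = (M \<omega>, M' \<omega>)" for \<omega>
    have Z: "pair_model \<alpha> n \<Omega> Z" using \<Omega> M M' by (simp add: pair_model_def gaussian_model_def Z_def)
    define G where "G = {\<omega> \<in> space \<Omega>. ham n (Z \<omega>) \<le> g n}"
    \<comment> \<open>Measurability is required to compare \<open>prob G\<close> with the
      probability of the complement of \<open>E\<close> by monotonicity.\<close>
    have G: "G \<in> events"
    proof -
      have M1[measurable]: "(\<lambda>\<omega>. kim_roche C (num_rows \<alpha> n) n (M \<omega>) t) \<in> borel_measurable \<Omega>" for t
        unfolding kim_roche_def
        by (rule kr_sigma_measurable) (auto intro: iid_gaussian_matrix_measurable[OF M])
      have M2[measurable]: "(\<lambda>\<omega>. kim_roche C (num_rows \<alpha> n) n (perturbed n (Z \<omega>)) t) \<in> borel_measurable \<Omega>" for t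
        unfolding kim_roche_def
      proof (rule kr_sigma_measurable[where X = "\<lambda>\<omega>. perturbed n (Z \<omega>)"])
        fix i t assume it: "i < num_rows \<alpha> n" "t < n"
        have [measurable]: "(\<lambda>\<omega>. M \<omega> i t) \<in> borel_measurable \<Omega>" "(\<lambda>\<omega>. M' \<omega> i t) \<in> borel_measurable \<Omega>"
          using iid_gaussian_matrix_measurable[OF M it] iid_gaussian_matrix_measurable[OF M' it] by blast+
        show "(\<lambda>\<omega>. perturbed n (Z \<omega>) i t) \<in> borel_measurable \<Omega>"
          unfolding perturbed_def Z_def interpolate_def fst_conv snd_conv by measurable
      qed simp
      have "ham n (Z \<omega>) = (\<Sum>t<n. if kim_roche C (num_rows \<alpha> n) n (M \<omega>) t
          \<noteq> kim_roche C (num_rows \<alpha> n) n (perturbed n (Z \<omega>)) t then 1 else 0)" for \<omega>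
      proof -
        have "(\<Sum>t<n. if kim_roche C (num_rows \<alpha> n) n (M \<omega>) t
            \<noteq> kim_roche C (num_rows \<alpha> n) n (perturbed n (Z \<omega>)) t then 1 else 0 :: real)
          = (\<Sum>t | t < n \<and> kim_roche C (num_rows \<alpha> n) n (M \<omega>) t
            \<noteq> kim_roche C (num_rows \<alpha> n) n (perturbed n (Z \<omega>)) t. 1)"
          by (rule sum.mono_neutral_cong_right) auto
        then show ?thesis by (simp add: ham_def hamming_dist_def Z_def)
      qed
      then show ?thesis unfolding G_def by simp
    qed
    have "1 - real n powr (- 1 / 41) \<le> prob G"
    proof (cases "D n = {}")
      case True
      then have "G = space \<Omega>" using ham_le by (auto simp: G_def g_def)
      then show ?thesis by (simp add: prob_space)
    next
      case False
      then have "Max (D n) \<in> D n" using finD by simp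
      then have PD: "P (Max (D n)) n" by (intro N) (simp add: D_def)
      obtain E where E: "E \<in> events" "prob E \<le> real n powr (- 1 / 41)"
        and EG: "\<And>\<omega>. \<omega> \<in> space \<Omega> - E \<Longrightarrow> ham n (Z \<omega>) \<le> 1 / real (Suc (Max (D n))) * real n"
        using PD[unfolded P_def, rule_format, OF Z] by blast
      have "space \<Omega> - E \<subseteq> G" using EG False by (auto simp: G_def g_def)
      then have "prob (space \<Omega> - E) \<le> prob G" using G by (rule finite_measure_mono)
      then show ?thesis using E by (simp add: prob_compl)
    qed
    then show ?thesis by (simp add: G_def ham_def Z_def perturbed_def)
  qed
  with g show ?thesis
    by (intro exI[of _ g] exI[of _ "\<lambda>n. real n powr (- 1 / 41)"] conjI) auto
qed

end
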